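(* Let $W$ be a finitely generated Coxeter group with Coxeter system $(W,S)$ and presentation diagram $\Gamma=\Gamma(W,S)$. The following are equivalent: (1) $W$ has more than one end. (2) $W$ decomposes as a nontrivial amalgamated product $A*_C B$ where $C$ is finite and $A$, $B$ and $C$ are special subgroups of $(W,S)$. (3) $\Gamma$ contains a complete separating subgraph, the vertices of which generate a finite subgroup of $W$.
   Context: A Coxeter system $(W,S)$ is a group $W$ with generating set $S$ having a presentation $\langle S : (st)^{m(s,t)}\ (s,t\in S,\ m(s,t)<\infty)\rangle$, where $m:S^2\to\{1,2,\ldots,\infty\}$, $m(s,t)=m(t,s)$, and $m(s,t)=1$ iff $s=t$. A special subgroup is a subgroup generated by a subset of $S$. The presentation diagram $\Gamma(W,S)$ is the labeled graph with vertex set $S$ and an edge labeled $m(s,t)$ between distinct $s,t\in S$ exactly when $m(s,t)<\infty$. An induced subgraph $\Gamma_0$ of $\Gamma$ separates $\Gamma$ if $\Gamma-\Gamma_0$ (the subgraph induced on the vertices not in $\Gamma_0$) has at least two connected components. The empty subgraph is allowed as a complete subgraph; it generates the trivial subgroup. An amalgamated product $A*_CB$ is nontrivial if $A\neq C\neq B$. *)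

theory Defs
  imports "HOL-Algebra.Generated_Groups" "HOL-Library.Extended_Nat"
begin

section \<open>Presented groups\<close>

text \<open>The letter \<open>(x, True)\<close> stands for the generator \<open>x\<close> and \<open>(x, False)\<close> for its formal inverse.\<close>

type_synonym 'x word = "('x \<times> bool) list"

definition words :: "'x set \<Rightarrow> 'x word set" where
  "words X = lists (X \<times> UNIV)"

inductive_set word_equiv :: "'x set \<Rightarrow> 'x word set \<Rightarrow> ('x word \<times> 'x word) set"
  for X :: "'x set" and R :: "'x word set" where
  refl: "w \<in> words X \<Longrightarrow> (w, w) \<in> word_equiv X R"
| sym: "(v, w) \<in> word_equiv X R \<Longrightarrow> (w, v) \<in> word_equiv X R"
| trans: "(u, v) \<in> word_equiv X R \<Longrightarrow> (v, w) \<in> word_equiv X R \<Longrightarrow> (u, w) \<in> word_equiv X R"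
| cancel: "u \<in> words X \<Longrightarrow> v \<in> words X \<Longrightarrow> x \<in> X
    \<Longrightarrow> (u @ [(x, b), (x, \<not> b)] @ v, u @ v) \<in> word_equiv X R"
| relator: "u \<in> words X \<Longrightarrow> v \<in> words X \<Longrightarrow> r \<in> R \<Longrightarrow> r \<in> words X
    \<Longrightarrow> (u @ r @ v, u @ v) \<in> word_equiv X R"

text \<open>The group \<open>\<langle>X | R\<rangle>\<close>: the quotient of the free group on \<open>X\<close> by the normal closure of \<open>R\<close>,
  as equivalence classes of words.\<close>

definition presented_group :: "'x set \<Rightarrow> 'x word set \<Rightarrow> 'x word set monoid" where
  "presented_group X R =
    \<lparr>carrier = words X // word_equiv X R,
     mult = (\<lambda>U V. \<Union>u\<in>U. \<Union>v\<in>V. word_equiv X R `` {u @ v}),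
     one = word_equiv X R `` {[]}\<rparr>"

definition presented_gen :: "'x set \<Rightarrow> 'x word set \<Rightarrow> 'x \<Rightarrow> 'x word set" where
  "presented_gen X R x = word_equiv X R `` {[(x, True)]}"

definition has_presentation :: "('a, 'b) monoid_scheme \<Rightarrow> 'a set \<Rightarrow> 'a word set \<Rightarrow> bool" where
  "has_presentation G X R \<longleftrightarrow>
    X \<subseteq> carrier G \<and>
    (\<exists>\<phi> \<in> iso (presented_group X R) G. \<forall>x\<in>X. \<phi> (presented_gen X R x) = x)"

lemma equiv_word_equiv: "equiv (words X) (word_equiv X R)"
proof (rule equivI)
  have "v \<in> words X \<and> w \<in> words X" if "(v, w) \<in> word_equiv X R" for v w
    using that by induction (auto simp: words_def)
  then show "word_equiv X R \<subseteq> words X \<times> words X" by auto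
  show "refl_on (words X) (word_equiv X R)"
    by (auto simp: refl_on_def intro: word_equiv.refl)
  show "sym (word_equiv X R)" by (auto intro!: symI intro: word_equiv.sym)
  show "trans (word_equiv X R)" by (auto intro!: transI intro: word_equiv.trans)
qed

lemma word_equiv_in_words:
  assumes "(v, w) \<in> word_equiv X R"
  shows "v \<in> words X" "w \<in> words X"
  using equiv_type[OF equiv_word_equiv[of X R]] assms by auto

lemma word_equiv_context:
  assumes "(v, w) \<in> word_equiv X R" "p \<in> words X" "q \<in> words X"
  shows "(p @ v @ q, p @ w @ q) \<in> word_equiv X R"
  using assms
proof (induction)
  case (refl w)
  then show ?case by (intro word_equiv.refl) (auto simp: words_def)
next
  case (sym v w)
  then show ?case by (blast intro: word_equiv.sym)
next
  case (trans u v w)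
  then show ?case by (blast intro: word_equiv.trans)
next
  case (cancel u v x b)
  then show ?case
    using word_equiv.cancel[of "p @ u" X "v @ q" x b R] by (auto simp: words_def)
next
  case (relator u v r)
  then show ?case
    using word_equiv.relator[of "p @ u" X "v @ q" r R] by (auto simp: words_def)
qed

lemma word_equiv_append:
  assumes "(v, v') \<in> word_equiv X R" "(w, w') \<in> word_equiv X R"
  shows "(v @ w, v' @ w') \<in> word_equiv X R"
proof -
  have nil: "[] \<in> words X" by (simp add: words_def)
  have "(v @ w, v' @ w) \<in> word_equiv X R"
    using word_equiv_context[OF assms(1) nil word_equiv_in_words(1)[OF assms(2)]] by simp
  moreover have "(v' @ w, v' @ w') \<in> word_equiv X R"
    using word_equiv_context[OF assms(2) word_equiv_in_words(2)[OF assms(1)] nil] by simp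
  ultimately show ?thesis by (rule word_equiv.trans)
qed

lemma presented_mult:
  assumes "v \<in> words X" "w \<in> words X"
  shows "word_equiv X R `` {v} \<otimes>\<^bsub>presented_group X R\<^esub> word_equiv X R `` {w}
    = word_equiv X R `` {v @ w}"
proof -
  let ?E = "word_equiv X R"
  have "?E `` {v' @ w'} = ?E `` {v @ w}" if "v' \<in> ?E `` {v}" "w' \<in> ?E `` {w}" for v' w'
  proof -
    have "(v @ w, v' @ w') \<in> ?E" using that by (intro word_equiv_append) simp_all
    then show ?thesis by (rule equiv_class_eq[OF equiv_word_equiv, symmetric])
  qed
  moreover have "v \<in> ?E `` {v}" "w \<in> ?E `` {w}"
    using assms by (simp_all add: word_equiv.refl)
  ultimately have "(\<Union>v'\<in>?E `` {v}. \<Union>w'\<in>?E `` {w}. ?E `` {v' @ w'}) = ?E `` {v @ w}"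
    by blast
  then show ?thesis by (simp add: presented_group_def)
qed

lemma word_equiv_inverse:
  assumes "w \<in> words X"
  shows "(rev (map (\<lambda>(x, b). (x, \<not> b)) w) @ w, []) \<in> word_equiv X R"
  using assms
proof (induction w)
  case Nil
  then show ?case by (auto intro: word_equiv.refl)
next
  case (Cons l w)
  obtain x b where l: "l = (x, b)" by (cases l)
  let ?r = "rev (map (\<lambda>(x, b). (x, \<not> b)) w)"
  have w: "w \<in> words X" "x \<in> X" using Cons.prems l by (auto simp: words_def)
  then have r: "?r \<in> words X" by (auto simp: words_def)
  from word_equiv.trans[OF word_equiv.cancel[OF r w(1) w(2), of "\<not> b" R] Cons.IH[OF w(1)]]
  show ?case by (simp add: l)
qed

lemma group_presented_group: "group (presented_group X R)"
proof (rule groupI)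
  let ?E = "word_equiv X R" and ?G = "presented_group X R"
  have carI: "?E `` {u} \<in> carrier ?G" if "u \<in> words X" for u
    using that by (simp add: presented_group_def quotientI)
  have carE: "\<exists>u\<in>words X. U = ?E `` {u}" if "U \<in> carrier ?G" for U
    using that by (auto simp: presented_group_def elim: quotientE)
  have nil: "[] \<in> words X" by (simp add: words_def)
  have app: "u @ v \<in> words X" if "u \<in> words X" "v \<in> words X" for u v
    using that by (auto simp: words_def)
  have one: "\<one>\<^bsub>?G\<^esub> = ?E `` {[]}" by (simp add: presented_group_def)
  show "x \<otimes>\<^bsub>?G\<^esub> y \<in> carrier ?G" if xy: "x \<in> carrier ?G" "y \<in> carrier ?G" for x y
  proof -
    obtain u v where "u \<in> words X" "x = ?E `` {u}" "v \<in> words X" "y = ?E `` {v}"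
      using carE[OF xy(1)] carE[OF xy(2)] by blast
    then show ?thesis by (simp add: presented_mult carI app)
  qed
  show "\<one>\<^bsub>?G\<^esub> \<in> carrier ?G" unfolding one by (rule carI[OF nil])
  show "x \<otimes>\<^bsub>?G\<^esub> y \<otimes>\<^bsub>?G\<^esub> z = x \<otimes>\<^bsub>?G\<^esub> (y \<otimes>\<^bsub>?G\<^esub> z)"
    if xyz: "x \<in> carrier ?G" "y \<in> carrier ?G" "z \<in> carrier ?G" for x y z
  proof -
    obtain u v w where "u \<in> words X" "x = ?E `` {u}" "v \<in> words X" "y = ?E `` {v}"
        "w \<in> words X" "z = ?E `` {w}"
      using carE[OF xyz(1)] carE[OF xyz(2)] carE[OF xyz(3)] by blast
    then show ?thesis by (simp add: presented_mult app)
  qed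
  show "\<one>\<^bsub>?G\<^esub> \<otimes>\<^bsub>?G\<^esub> x = x" if x: "x \<in> carrier ?G" for x
    using carE[OF x] by (auto simp only: one presented_mult nil append_Nil)
  show "\<exists>y\<in>carrier ?G. y \<otimes>\<^bsub>?G\<^esub> x = \<one>\<^bsub>?G\<^esub>" if x: "x \<in> carrier ?G" for x
  proof -
    obtain w where w: "w \<in> words X" "x = ?E `` {w}" using carE[OF x] by blast
    let ?r = "rev (map (\<lambda>(x, b). (x, \<not> b)) w)"
    have r: "?r \<in> words X" using w(1) by (auto simp: words_def)
    have "?E `` {?r} \<otimes>\<^bsub>?G\<^esub> x = ?E `` {?r @ w}" using r w by (simp add: presented_mult)
    also have "\<dots> = \<one>\<^bsub>?G\<^esub>"
      using equiv_class_eq[OF equiv_word_equiv word_equiv_inverse[OF w(1)]] by (simp add: one)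
    finally show ?thesis using carI[OF r] by blast
  qed
qed


section \<open>Coxeter systems\<close>

definition coxeter_relators :: "'a set \<Rightarrow> ('a \<Rightarrow> 'a \<Rightarrow> enat) \<Rightarrow> 'a word set" where
  "coxeter_relators S m =
    {concat (replicate (the_enat (m s t)) [(s, True), (t, True)]) | s t.
      s \<in> S \<and> t \<in> S \<and> m s t < \<infinity>}"

definition coxeter_system ::
    "('a, 'b) monoid_scheme \<Rightarrow> 'a set \<Rightarrow> ('a \<Rightarrow> 'a \<Rightarrow> enat) \<Rightarrow> bool" where
  "coxeter_system W S m \<longleftrightarrow>
    group W \<and> S \<subseteq> carrier W \<and> generate W S = carrier W \<and>
    (\<forall>s\<in>S. \<forall>t\<in>S. 1 \<le> m s t \<and> m s t = m t s \<and> (m s t = 1 \<longleftrightarrow> s = t)) \<and>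
    has_presentation W S (coxeter_relators S m)"

definition special_subgroup :: "('a, 'b) monoid_scheme \<Rightarrow> 'a set \<Rightarrow> 'a set \<Rightarrow> bool" where
  "special_subgroup W S A \<longleftrightarrow> (\<exists>T\<subseteq>S. A = generate W T)"

definition finitely_generated :: "('a, 'b) monoid_scheme \<Rightarrow> bool" where
  "finitely_generated G \<longleftrightarrow>
    (\<exists>X. finite X \<and> X \<subseteq> carrier G \<and> generate G X = carrier G)"


section \<open>Amalgamated products\<close>

text \<open>The pushout of \<open>f : C \<rightarrow> A\<close> and \<open>g : C \<rightarrow> B\<close>: generators are the disjoint union of \<open>A\<close> and \<open>B\<close>,
  relators are the two multiplication tables together with \<open>f c = g c\<close>.\<close>

definition amalgam_relators ::
    "('a, 'm) monoid_scheme \<Rightarrow> ('b, 'n) monoid_scheme \<Rightarrow> ('c, 'k) monoid_scheme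
      \<Rightarrow> ('c \<Rightarrow> 'a) \<Rightarrow> ('c \<Rightarrow> 'b) \<Rightarrow> ('a + 'b) word set" where
  "amalgam_relators A B C f g =
    {[(Inl x, True), (Inl y, True), (Inl (x \<otimes>\<^bsub>A\<^esub> y), False)] | x y. x \<in> carrier A \<and> y \<in> carrier A} \<union>
    {[(Inr x, True), (Inr y, True), (Inr (x \<otimes>\<^bsub>B\<^esub> y), False)] | x y. x \<in> carrier B \<and> y \<in> carrier B} \<union>
    {[(Inl (f c), True), (Inr (g c), False)] | c. c \<in> carrier C}"

definition amalgam ::
    "('a, 'm) monoid_scheme \<Rightarrow> ('b, 'n) monoid_scheme \<Rightarrow> ('c, 'k) monoid_scheme
      \<Rightarrow> ('c \<Rightarrow> 'a) \<Rightarrow> ('c \<Rightarrow> 'b) \<Rightarrow> ('a + 'b) word set monoid" where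
  "amalgam A B C f g = presented_group (carrier A <+> carrier B) (amalgam_relators A B C f g)"

definition amalgam_gen ::
    "('a, 'm) monoid_scheme \<Rightarrow> ('b, 'n) monoid_scheme \<Rightarrow> ('c, 'k) monoid_scheme
      \<Rightarrow> ('c \<Rightarrow> 'a) \<Rightarrow> ('c \<Rightarrow> 'b) \<Rightarrow> 'a + 'b \<Rightarrow> ('a + 'b) word set" where
  "amalgam_gen A B C f g = presented_gen (carrier A <+> carrier B) (amalgam_relators A B C f g)"

text \<open>\<open>W = A *\<^sub>C B\<close> for subgroups \<open>C \<le> A, B\<close> of \<open>W\<close>: the homomorphism from the amalgamated product
  to \<open>W\<close> induced by the inclusions of \<open>A\<close> and \<open>B\<close> is an isomorphism.\<close>

definition decomposes_as_amalgam ::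
    "('a, 'b) monoid_scheme \<Rightarrow> 'a set \<Rightarrow> 'a set \<Rightarrow> 'a set \<Rightarrow> bool" where
  "decomposes_as_amalgam W A C B \<longleftrightarrow>
    subgroup A W \<and> subgroup B W \<and> subgroup C W \<and> C \<subseteq> A \<and> C \<subseteq> B \<and>
    (let WA = W\<lparr>carrier := A\<rparr>; WB = W\<lparr>carrier := B\<rparr>; WC = W\<lparr>carrier := C\<rparr>
     in \<exists>\<phi> \<in> iso (amalgam WA WB WC id id) W.
          (\<forall>a\<in>A. \<phi> (amalgam_gen WA WB WC id id (Inl a)) = a) \<and>
          (\<forall>b\<in>B. \<phi> (amalgam_gen WA WB WC id id (Inr b)) = b))"

definition nontrivial_amalgam_decomposition ::
    "('a, 'b) monoid_scheme \<Rightarrow> 'a set \<Rightarrow> 'a set \<Rightarrow> 'a set \<Rightarrow> bool" where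
  "nontrivial_amalgam_decomposition W A C B \<longleftrightarrow>
    decomposes_as_amalgam W A C B \<and> A \<noteq> C \<and> C \<noteq> B"


section \<open>Graphs\<close>

text \<open>An undirected edge between \<open>u\<close> and \<open>v\<close> is represented by both pairs \<open>(u, v)\<close> and \<open>(v, u)\<close>.\<close>

record 'v graph =
  verts :: "'v set"
  edges :: "('v \<times> 'v) set"

record 'v labeled_graph = "'v graph" +
  label :: "'v \<times> 'v \<Rightarrow> enat"

definition induced_subgraph :: "('v, 'b) graph_scheme \<Rightarrow> 'v set \<Rightarrow> ('v, 'b) graph_scheme" where
  "induced_subgraph G T = G\<lparr>verts := verts G \<inter> T, edges := edges G \<inter> T \<times> T\<rparr>"

definition remove_verts :: "('v, 'b) graph_scheme \<Rightarrow> 'v set \<Rightarrow> ('v, 'b) graph_scheme" where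
  "remove_verts G T = induced_subgraph G (verts G - T)"

definition components :: "('v, 'b) graph_scheme \<Rightarrow> 'v set set" where
  "components G = verts G // {(u, v). u \<in> verts G \<and> v \<in> verts G \<and> (u, v) \<in> (edges G)\<^sup>*}"

definition complete_graph :: "('v, 'b) graph_scheme \<Rightarrow> bool" where
  "complete_graph G \<longleftrightarrow> (\<forall>u\<in>verts G. \<forall>v\<in>verts G. u \<noteq> v \<longrightarrow> (u, v) \<in> edges G)"

definition ecard :: "'a set \<Rightarrow> enat" where
  "ecard A = (if finite A then enat (card A) else \<infinity>)"

definition separates :: "'v set \<Rightarrow> ('v, 'b) graph_scheme \<Rightarrow> bool" where
  "separates T G \<longleftrightarrow> 2 \<le> ecard (components (remove_verts G T))"

definition presentation_diagram :: "'a set \<Rightarrow> ('a \<Rightarrow> 'a \<Rightarrow> enat) \<Rightarrow> 'a labeled_graph" where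
  "presentation_diagram S m =
    \<lparr>verts = S,
     edges = {(s, t). s \<in> S \<and> t \<in> S \<and> s \<noteq> t \<and> m s t < \<infinity>},
     label = (\<lambda>(s, t). m s t)\<rparr>"


section \<open>Ends\<close>

text \<open>For a connected locally finite graph this is the cardinality of its space of ends,
  with \<open>\<infinity>\<close> for every infinite cardinality.\<close>

definition graph_ends :: "('v, 'b) graph_scheme \<Rightarrow> enat" where
  "graph_ends G =
    (SUP K \<in> {K. finite K \<and> K \<subseteq> verts G}.
      ecard {D \<in> components (remove_verts G K). infinite D})"

definition cayley_graph :: "('a, 'b) monoid_scheme \<Rightarrow> 'a set \<Rightarrow> 'a graph" where
  "cayley_graph G X =
    \<lparr>verts = carrier G,
     edges = {(g, h). g \<in> carrier G \<and> h \<in> carrier G \<and>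
       (\<exists>x\<in>X. h = g \<otimes>\<^bsub>G\<^esub> x \<or> g = h \<otimes>\<^bsub>G\<^esub> x)}\<rparr>"

text \<open>Only meaningful for finitely generated \<open>G\<close>; the value is then independent of the chosen finite
  generating set, since Cayley graphs for different ones are quasi-isometric.\<close>

definition num_ends :: "('a, 'b) monoid_scheme \<Rightarrow> enat" where
  "num_ends G =
    graph_ends (cayley_graph G
      (SOME X. finite X \<and> X \<subseteq> carrier G \<and> generate G X = carrier G))"

end

theory Submission
  imports Defs
begin

text \<open>The proof runs through (2) \<open>\<Longrightarrow>\<close> (1) \<open>\<Longrightarrow>\<close> (3) \<open>\<Longrightarrow>\<close> (2) and avoids Stallings' theorem.

  For (2) \<open>\<Longrightarrow>\<close> (1), the elements of \<open>A *\<^sub>C B\<close> whose normal form ends in a syllable from \<open>B - C\<close> form an infinite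
  and coinfinite set that every left multiplication preserves up to finitely many elements.

  For (1) \<open>\<Longrightarrow>\<close> (3), suppose that no complete subgraph generating a finite subgroup separates \<open>\<Gamma>\<close>. Then the
  elements of length at least \<open>n\<close> span a connected subgraph of the Cayley graph, by induction on \<open>n\<close>: when an
  element \<open>w\<close> of length \<open>n\<close> is removed, its upper neighbours are the \<open>w s\<close> for \<open>s\<close> outside the descent set \<open>T\<close>
  of \<open>w\<close>. The group generated by \<open>T\<close> is finite, so \<open>\<Gamma> - T\<close> is connected, and along an edge \<open>{s, t}\<close> of
  \<open>\<Gamma> - T\<close> one gets from \<open>w s\<close> to \<open>w t\<close> around the polygon \<open>w \<langle>s, t\<rangle>\<close>, whose other vertices are longer
  than \<open>w\<close>.

  For (3) \<open>\<Longrightarrow>\<close> (2), the Coxeter relations of \<open>W\<close> already hold in the amalgamated product. The case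
  \<open>T = S - {s, t}\<close> with \<open>m s t = \<infinity>\<close> shows that \<open>s t\<close> has infinite order, hence that generators of a
  finite special subgroup span a complete graph.\<close>

section \<open>Presentations\<close>

lemma words_simps [simp]:
  "[] \<in> words X"
  "(x, b) # w \<in> words X \<longleftrightarrow> x \<in> X \<and> w \<in> words X"
  "v @ w \<in> words X \<longleftrightarrow> v \<in> words X \<and> w \<in> words X"
  by (auto simp: words_def)

lemma words_induct [consumes 1, case_names Nil Cons]:
  assumes "w \<in> words X"
    and "Q []"
    and "\<And>x b w. x \<in> X \<Longrightarrow> w \<in> words X \<Longrightarrow> Q w \<Longrightarrow> Q ((x, b) # w)"
  shows "Q w"
  using assms(1) by (induction w) (use assms(2,3) in auto)

section \<open>Actions of words on a set\<close>

lemma foldr_words_closed: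
  assumes "\<And>x b y. x \<in> X \<Longrightarrow> y \<in> P \<Longrightarrow> act (x, b) y \<in> P"
    and "w \<in> words X" "y \<in> P"
  shows "foldr act w y \<in> P"
  using assms(2) by (induction w rule: words_induct) (auto simp: assms(1,3))

text \<open>Induction along the derivation: what stands to the right of a cancelling pair or a
  relator only moves the point within \<open>P\<close>, where the pair or relator then acts
  trivially. Presented groups are made to act this way without forming a group of
  permutations.\<close>

lemma foldr_word_equiv:
  assumes closed: "\<And>x b y. x \<in> X \<Longrightarrow> y \<in> P \<Longrightarrow> act (x, b) y \<in> P"
    and inv: "\<And>x b y. x \<in> X \<Longrightarrow> y \<in> P \<Longrightarrow> act (x, b) (act (x, \<not> b) y) = y"
    and rel: "\<And>r y. r \<in> R \<Longrightarrow> r \<in> words X \<Longrightarrow> y \<in> P \<Longrightarrow> foldr act r y = y"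
    and "(v, w) \<in> word_equiv X R" "y \<in> P"
  shows "foldr act v y = foldr act w y"
  using assms(4,5)
proof (induction arbitrary: y)
  case (cancel u v x b)
  then show ?case using inv foldr_words_closed[of X P act, OF closed] by simp
next
  case (relator u v r)
  then show ?case using rel foldr_words_closed[of X P act, OF closed] by simp
qed auto

text \<open>Letters act by left multiplication, so that evaluation in \<open>G\<close> is an
  instance of the \<open>foldr\<close> actions above.\<close>

definition word_value :: "('g, 'm) monoid_scheme \<Rightarrow> ('x \<Rightarrow> 'g) \<Rightarrow> 'x word \<Rightarrow> 'g" where
  "word_value G f w =
    foldr (\<lambda>(x, b) g. (if b then f x else inv\<^bsub>G\<^esub> f x) \<otimes>\<^bsub>G\<^esub> g) w \<one>\<^bsub>G\<^esub>"

lemma word_value_simps [simp]: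
  "word_value G f [] = \<one>\<^bsub>G\<^esub>"
  "word_value G f ((x, b) # w) = (if b then f x else inv\<^bsub>G\<^esub> f x) \<otimes>\<^bsub>G\<^esub> word_value G f w"
  by (simp_all add: word_value_def)

context group
begin

lemma word_value_closed [simp]:
  assumes "f \<in> X \<rightarrow> carrier G" "w \<in> words X"
  shows "word_value G f w \<in> carrier G"
  using assms(2) by (induction w rule: words_induct) (use assms(1) in auto)

lemma word_value_append:
  assumes "f \<in> X \<rightarrow> carrier G" "v \<in> words X" "w \<in> words X"
  shows "word_value G f (v @ w) = word_value G f v \<otimes> word_value G f w"
  using assms(2)
proof (induction v rule: words_induct)
  case Nil
  then show ?case using assms(1,3) by simp
next
  case (Cons x b v)
  then have "f x \<in> carrier G" using assms(1) by auto
  then show ?case using Cons assms by (simp add: m_assoc)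
qed

lemma word_value_in_generate:
  assumes "f \<in> X \<rightarrow> carrier G" "w \<in> words X"
  shows "word_value G f w \<in> generate G (f ` X)"
  using assms(2)
  by (induction w rule: words_induct)
    (auto intro: generate.one generate.eng generate.incl generate.inv)

text \<open>On \<open>carrier G\<close> a word acts by left multiplication with its value, so a
  relator of value \<one> acts trivially. Two equivalent words then agree at \<one>.\<close>

lemma word_value_word_equiv:
  assumes f: "f \<in> X \<rightarrow> carrier G"
    and rel: "\<And>r. r \<in> R \<Longrightarrow> r \<in> words X \<Longrightarrow> word_value G f r = \<one>"
    and vw: "(v, w) \<in> word_equiv X R"
  shows "word_value G f v = word_value G f w"
proof -
  let ?act = "\<lambda>(x, b) g. (if b then f x else inv f x) \<otimes> g"
  have fold: "foldr ?act w g = word_value G f w \<otimes> g" if "w \<in> words X" "g \<in> carrier G" for w g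
    using that(1)
  proof (induction w rule: words_induct)
    case Nil
    then show ?case using that(2) by simp
  next
    case (Cons x b w)
    then have "f x \<in> carrier G" using f by auto
    then show ?case using Cons that(2) f by (simp add: m_assoc)
  qed
  have "foldr ?act v \<one> = foldr ?act w \<one>"
  proof (rule foldr_word_equiv[where P = "carrier G", OF _ _ _ vw])
    show "?act (x, b) y \<in> carrier G" if "x \<in> X" "y \<in> carrier G" for x b y
      using f that by auto
    show "?act (x, b) (?act (x, \<not> b) y) = y" if "x \<in> X" "y \<in> carrier G" for x b y
    proof -
      have "f x \<in> carrier G" using f that by auto
      then show ?thesis using that(2) by (simp add: m_assoc[symmetric])
    qed
    show "foldr ?act r y = y" if "r \<in> R" "r \<in> words X" "y \<in> carrier G" for r y
      using fold[OF that(2,3)] rel that by simp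
  qed simp
  then show ?thesis unfolding word_value_def .
qed

end

section \<open>Presentations in terms of word values\<close>

lemma presented_group_inv_gen:
  assumes "x \<in> X"
  shows "inv\<^bsub>presented_group X R\<^esub> presented_gen X R x = word_equiv X R `` {[(x, False)]}"
proof -
  interpret P: group "presented_group X R" by (rule group_presented_group)
  let ?y = "word_equiv X R `` {[(x, False)]}"
  have car: "?y \<in> carrier (presented_group X R)" "presented_gen X R x \<in> carrier (presented_group X R)"
    using assms by (auto simp: presented_group_def presented_gen_def intro!: quotientI)
  have "([(x, False), (x, True)], []) \<in> word_equiv X R"
    using word_equiv.cancel[of "[]" X "[]" x False R] assms by simp
  then have "word_equiv X R `` {[(x, False), (x, True)]} = \<one>\<^bsub>presented_group X R\<^esub>"
    using equiv_class_eq[OF equiv_word_equiv] by (simp add: presented_group_def)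
  then have "?y \<otimes>\<^bsub>presented_group X R\<^esub> presented_gen X R x = \<one>\<^bsub>presented_group X R\<^esub>"
    using assms by (simp add: presented_gen_def presented_mult)
  then show ?thesis using P.inv_equality[OF _ car(2,1)] by simp
qed

lemma presented_gen_closed:
  "x \<in> X \<Longrightarrow> presented_gen X R x \<in> carrier (presented_group X R)"
  by (auto simp: presented_group_def presented_gen_def intro!: quotientI)

lemma word_value_presented_gen:
  assumes "w \<in> words X"
  shows "word_value (presented_group X R) (presented_gen X R) w = word_equiv X R `` {w}"
  using assms
proof (induction w rule: words_induct)
  case Nil
  then show ?case by (simp add: presented_group_def)
next
  case (Cons x b w)
  then have "(if b then presented_gen X R x else inv\<^bsub>presented_group X R\<^esub> presented_gen X R x)
      = word_equiv X R `` {[(x, b)]}"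
    using presented_group_inv_gen[of x X R] by (cases b) (simp_all add: presented_gen_def)
  then show ?case using Cons presented_mult[of "[(x, b)]" X w R] by simp
qed

lemma hom_word_value:
  assumes "group G" "group H" "\<phi> \<in> hom G H" "f \<in> X \<rightarrow> carrier G" "w \<in> words X"
  shows "\<phi> (word_value G f w) = word_value H (\<phi> \<circ> f) w"
  using assms(5)
proof (induction w rule: words_induct)
  interpret group_hom G H \<phi> using assms(1-3) by (simp add: group_hom_def group_hom_axioms_def)
  {
    case Nil
    then show ?case by simp
  next
    case (Cons x b w)
    then have "f x \<in> carrier G" using assms(4) by auto
    then show ?case using Cons assms by simp
  }
qed

text \<open>A group presented by \<open>\<langle>X | R\<rangle>\<close> through a map \<open>f\<close> that need not be an inclusion; it is not
  one for the amalgamated product.\<close>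

definition presents ::
    "('g, 'm) monoid_scheme \<Rightarrow> 'x set \<Rightarrow> 'x word set \<Rightarrow> ('x \<Rightarrow> 'g) \<Rightarrow> bool" where
  "presents G X R f \<longleftrightarrow> (\<exists>\<phi> \<in> iso (presented_group X R) G. \<forall>x\<in>X. \<phi> (presented_gen X R x) = f x)"

text \<open>The only candidate for the isomorphism sends the class of \<open>w\<close> to
  \<open>word_value G f w\<close>, so its existence becomes a condition on words. Later lemmas
  unfold \<open>presents\<close> in this form.\<close>

lemma presents_iff:
  assumes "group G"
  shows "presents G X R f \<longleftrightarrow>
    f \<in> X \<rightarrow> carrier G \<and> word_value G f ` words X = carrier G \<and>
    (\<forall>v\<in>words X. \<forall>w\<in>words X. (v, w) \<in> word_equiv X R \<longleftrightarrow> word_value G f v = word_value G f w)"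
    (is "_ \<longleftrightarrow> ?f \<and> ?surj \<and> ?eq")
proof -
  interpret group G by fact
  let ?P = "presented_group X R" and ?E = "word_equiv X R"
  have car: "carrier ?P = words X // ?E" by (simp add: presented_group_def)
  show ?thesis
  proof
    assume "presents G X R f"
    then obtain \<phi> where \<phi>: "\<phi> \<in> iso ?P G" and gen: "\<And>x. x \<in> X \<Longrightarrow> \<phi> (presented_gen X R x) = f x"
      by (auto simp: presents_def)
    have hom: "\<phi> \<in> hom ?P G" and bij: "bij_betw \<phi> (carrier ?P) (carrier G)"
      using \<phi> by (auto simp: iso_def)
    have f: ?f
      using gen hom presented_gen_closed[of _ X R] by (metis Pi_I hom_in_carrier)
    have val: "\<phi> (?E `` {w}) = word_value G f w" if w: "w \<in> words X" for w
    proof -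
      have "\<phi> (?E `` {w}) = word_value G (\<phi> \<circ> presented_gen X R) w"
        using hom_word_value[OF group_presented_group assms hom _ w] presented_gen_closed
          word_value_presented_gen[OF w] by (metis Pi_I)
      also have "\<dots> = word_value G f w"
        using w by (induction w rule: words_induct) (auto simp: gen)
      finally show ?thesis .
    qed
    have "carrier G = \<phi> ` (words X // ?E)"
      using bij by (simp add: bij_betw_def car)
    also have "\<dots> = word_value G f ` words X"
      using val by (auto simp: quotient_def image_UN)
    finally have surj: ?surj by simp
    have ?eq
    proof (intro ballI)
      fix v w
      assume vw: "v \<in> words X" "w \<in> words X"
      have "(v, w) \<in> ?E \<longleftrightarrow> ?E `` {v} = ?E `` {w}"
        using eq_equiv_class_iff[OF equiv_word_equiv vw] by simp
      also have "\<dots> \<longleftrightarrow> \<phi> (?E `` {v}) = \<phi> (?E `` {w})"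
        using bij vw by (auto simp: bij_betw_def car quotientI dest: inj_onD)
      finally show "(v, w) \<in> ?E \<longleftrightarrow> word_value G f v = word_value G f w"
        by (simp add: val vw)
    qed
    with f surj show "?f \<and> ?surj \<and> ?eq" by simp
  next
    assume R: "?f \<and> ?surj \<and> ?eq"
    \<comment> \<open>Any representative of the class will do, since equivalent words have equal
      values.\<close>
    define \<phi> where "\<phi> = (\<lambda>U. word_value G f (SOME u. u \<in> U))"
    have val: "\<phi> (?E `` {w}) = word_value G f w" if w: "w \<in> words X" for w
    proof -
      have "(SOME u. u \<in> ?E `` {w}) \<in> ?E `` {w}"
        using word_equiv.refl[OF w] by (metis Image_singleton_iff someI)
      then have "(w, SOME u. u \<in> ?E `` {w}) \<in> ?E" by simp
      then show ?thesis unfolding \<phi>_def using R word_equiv_in_words by metis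
    qed
    have "\<phi> \<in> hom ?P G"
    proof (rule homI)
      show "\<phi> U \<in> carrier G" if "U \<in> carrier ?P" for U
        using that val R by (auto simp: car elim!: quotientE)
      show "\<phi> (U \<otimes>\<^bsub>?P\<^esub> V) = \<phi> U \<otimes>\<^bsub>G\<^esub> \<phi> V" if UV: "U \<in> carrier ?P" "V \<in> carrier ?P" for U V
      proof -
        obtain u v where uv: "u \<in> words X" "U = ?E `` {u}" "v \<in> words X" "V = ?E `` {v}"
          using UV by (auto simp: car elim!: quotientE)
        then show ?thesis
          using R by (simp add: presented_mult val word_value_append[of f X])
      qed
    qed
    moreover have "bij_betw \<phi> (carrier ?P) (carrier G)"
    proof (rule bij_betw_imageI)
      show "inj_on \<phi> (carrier ?P)"
      proof (rule inj_onI)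
        fix U V assume UV: "U \<in> carrier ?P" "V \<in> carrier ?P" "\<phi> U = \<phi> V"
        obtain u v where uv: "u \<in> words X" "U = ?E `` {u}" "v \<in> words X" "V = ?E `` {v}"
          using UV by (auto simp: car elim!: quotientE)
        then have "(u, v) \<in> ?E" using UV(3) val R by simp
        then show "U = V" using uv equiv_class_eq[OF equiv_word_equiv] by metis
      qed
      have "\<phi> ` (words X // ?E) = word_value G f ` words X"
        using val by (auto simp: quotient_def image_UN)
      then show "\<phi> ` carrier ?P = carrier G" using R by (simp add: car)
    qed
    moreover have "\<phi> (presented_gen X R x) = f x" if "x \<in> X" for x
    proof -
      have "f x \<in> carrier G" using R that by auto
      then show ?thesis using val[of "[(x, True)]"] that by (simp add: presented_gen_def)
    qed
    ultimately show "presents G X R f" unfolding presents_def iso_def by blast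
  qed
qed

lemma presents_generate:
  assumes "group G" "presents G X R f"
  shows "generate G (f ` X) = carrier G"
proof -
  interpret group G by fact
  have f: "f \<in> X \<rightarrow> carrier G" and surj: "word_value G f ` words X = carrier G"
    using assms(2) unfolding presents_iff[OF assms(1)] by simp_all
  show ?thesis
  proof
    show "generate G (f ` X) \<subseteq> carrier G" using f by (intro generate_incl) auto
    show "carrier G \<subseteq> generate G (f ` X)"
      unfolding surj[symmetric] using word_value_in_generate[OF f] by blast
  qed
qed

text \<open>\<open>F g\<close> lets a word for \<open>g\<close> act; by
  \<open>foldr_word_equiv\<close> the choice of the word is immaterial. The parity of words, the
  cocycle of Tits and the normal forms of amalgamated products are all actions obtained
  here.\<close>

lemma presents_action:
  assumes "group G" "presents G X R f"
    and closed: "\<And>x b y. x \<in> X \<Longrightarrow> y \<in> P \<Longrightarrow> act (x, b) y \<in> P"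
    and inv: "\<And>x b y. x \<in> X \<Longrightarrow> y \<in> P \<Longrightarrow> act (x, b) (act (x, \<not> b) y) = y"
    and rel: "\<And>r y. r \<in> R \<Longrightarrow> r \<in> words X \<Longrightarrow> y \<in> P \<Longrightarrow> foldr act r y = y"
  obtains F where "\<And>g y. g \<in> carrier G \<Longrightarrow> y \<in> P \<Longrightarrow> F g y \<in> P"
    and "\<And>y. y \<in> P \<Longrightarrow> F \<one>\<^bsub>G\<^esub> y = y"
    and "\<And>g h y. g \<in> carrier G \<Longrightarrow> h \<in> carrier G \<Longrightarrow> y \<in> P \<Longrightarrow> F (g \<otimes>\<^bsub>G\<^esub> h) y = F g (F h y)"
    and "\<And>x y. x \<in> X \<Longrightarrow> y \<in> P \<Longrightarrow> F (f x) y = act (x, True) y"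
proof -
  interpret group G by fact
  have f: "f \<in> X \<rightarrow> carrier G" and surj: "word_value G f ` words X = carrier G"
    and eq: "\<And>v w. v \<in> words X \<Longrightarrow> w \<in> words X \<Longrightarrow>
      (v, w) \<in> word_equiv X R \<longleftrightarrow> word_value G f v = word_value G f w"
    using assms(2) unfolding presents_iff[OF assms(1)] by simp_all
  define wd where "wd g = (SOME w. w \<in> words X \<and> word_value G f w = g)" for g
  have wd: "wd g \<in> words X" "word_value G f (wd g) = g" if "g \<in> carrier G" for g
  proof -
    have "\<exists>w. w \<in> words X \<and> word_value G f w = g" using that surj by (metis imageE)
    from someI_ex[OF this] show "wd g \<in> words X" "word_value G f (wd g) = g"
      by (auto simp: wd_def)
  qed
  define F where "F g = foldr act (wd g)" for g
  have F: "F (word_value G f w) y = foldr act w y" if "w \<in> words X" "y \<in> P" for w y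
  proof -
    have "(wd (word_value G f w), w) \<in> word_equiv X R"
      using that wd[of "word_value G f w"] f by (subst eq) auto
    from foldr_word_equiv[of X P act, OF closed inv rel this that(2)]
    show ?thesis by (simp add: F_def)
  qed
  show thesis
  proof (rule that[of F])
    show cl: "F g y \<in> P" if "g \<in> carrier G" "y \<in> P" for g y
      unfolding F_def using foldr_words_closed[of X P act, OF closed] wd that by blast
    show "F \<one>\<^bsub>G\<^esub> y = y" if "y \<in> P" for y
      using F[of "[]" y] that by simp
    show "F (g \<otimes>\<^bsub>G\<^esub> h) y = F g (F h y)" if "g \<in> carrier G" "h \<in> carrier G" "y \<in> P" for g h y
      using F[of "wd g @ wd h" y] wd[OF that(1)] wd[OF that(2)] that(3) f
      by (simp add: word_value_append[of f X] F_def)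
    show "F (f x) y = act (x, True) y" if "x \<in> X" "y \<in> P" for x y
    proof -
      have "f x \<in> carrier G" using f that(1) by auto
      then show ?thesis using F[of "[(x, True)]" y] that by simp
    qed
  qed
qed

text \<open>The map \<open>\<psi>\<close> undoes evaluation: it sends the value of \<open>w\<close>
  back to the class of \<open>w\<close>, so words of equal value are equivalent.\<close>

lemma presentsI:
  assumes "group G" and f: "f \<in> X \<rightarrow> carrier G"
    and rel: "\<And>r. r \<in> R \<Longrightarrow> r \<in> words X \<Longrightarrow> word_value G f r = \<one>\<^bsub>G\<^esub>"
    and gen: "carrier G \<subseteq> word_value G f ` words X"
    and \<psi>: "\<psi> \<in> hom G (presented_group X R)"
    and \<psi>_gen: "\<And>x. x \<in> X \<Longrightarrow> \<psi> (f x) = presented_gen X R x"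
  shows "presents G X R f"
proof -
  interpret group G by fact
  have inj: "(v, w) \<in> word_equiv X R"
    if vw: "v \<in> words X" "w \<in> words X" "word_value G f v = word_value G f w" for v w
  proof -
    have *: "\<psi> (word_value G f w) = word_equiv X R `` {w}" if w: "w \<in> words X" for w
    proof -
      have "\<psi> (word_value G f w) = word_value (presented_group X R) (\<psi> \<circ> f) w"
        by (rule hom_word_value[OF assms(1) group_presented_group \<psi> f w])
      also have "\<dots> = word_value (presented_group X R) (presented_gen X R) w"
        using w by (induction w rule: words_induct) (auto simp: \<psi>_gen)
      finally show ?thesis by (simp add: word_value_presented_gen w)
    qed
    then have "word_equiv X R `` {v} = word_equiv X R `` {w}" using vw by metis
    then show ?thesis using eq_equiv_class_iff[OF equiv_word_equiv vw(1,2)] by simp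
  qed
  have surj: "word_value G f ` words X = carrier G"
    using gen word_value_closed[OF f] by auto
  show ?thesis
    unfolding presents_iff[OF assms(1)]
    using f surj inj word_value_word_equiv[OF f rel] by blast
qed

text \<open>Von Dyck's theorem. \<open>\<psi> g\<close> is the value in \<open>H\<close> of any word
  for \<open>g\<close>, which is well defined because the relators hold in \<open>H\<close>.\<close>

lemma presents_hom:
  assumes "group G" "group H" "presents G X R f" and h: "h \<in> X \<rightarrow> carrier H"
    and rel: "\<And>r. r \<in> R \<Longrightarrow> r \<in> words X \<Longrightarrow> word_value H h r = \<one>\<^bsub>H\<^esub>"
  obtains \<psi> where "\<psi> \<in> hom G H" "\<And>x. x \<in> X \<Longrightarrow> \<psi> (f x) = h x"
proof -
  interpret G: group G by fact
  interpret H: group H by fact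
  have f: "f \<in> X \<rightarrow> carrier G" and surj: "word_value G f ` words X = carrier G"
    and eq: "\<And>v w. v \<in> words X \<Longrightarrow> w \<in> words X \<Longrightarrow>
      (v, w) \<in> word_equiv X R \<longleftrightarrow> word_value G f v = word_value G f w"
    using assms(3) unfolding presents_iff[OF assms(1)] by simp_all
  define \<psi> where "\<psi> g = word_value H h (SOME w. w \<in> words X \<and> word_value G f w = g)" for g
  have \<psi>: "\<psi> (word_value G f w) = word_value H h w" if w: "w \<in> words X" for w
  proof -
    let ?v = "SOME v. v \<in> words X \<and> word_value G f v = word_value G f w"
    have "?v \<in> words X \<and> word_value G f ?v = word_value G f w"
      by (rule someI[of _ w]) (use w in simp)
    then have "(?v, w) \<in> word_equiv X R" using w eq by blast
    from H.word_value_word_equiv[OF h rel this] show ?thesis by (simp add: \<psi>_def)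
  qed
  have rep: "\<exists>w\<in>words X. g = word_value G f w" if "g \<in> carrier G" for g
    using that surj by blast
  show thesis
  proof (rule that[of \<psi>])
    show "\<psi> \<in> hom G H"
    proof (rule homI)
      show "\<psi> g \<in> carrier H" if "g \<in> carrier G" for g
        using rep[OF that] h by (auto simp: \<psi>)
      show "\<psi> (g \<otimes>\<^bsub>G\<^esub> g') = \<psi> g \<otimes>\<^bsub>H\<^esub> \<psi> g'" if "g \<in> carrier G" "g' \<in> carrier G" for g g'
      proof -
        from rep[OF that(1)] rep[OF that(2)]
        obtain v w where v: "v \<in> words X" "g = word_value G f v"
          and w: "w \<in> words X" "g' = word_value G f w"
          by blast
        have "\<psi> (g \<otimes>\<^bsub>G\<^esub> g') = word_value H h (v @ w)"
          using \<psi>[of "v @ w"] v w f by (simp add: G.word_value_append[of f X])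
        then show ?thesis using v w h by (simp add: \<psi> H.word_value_append[of h X])
      qed
    qed
    show "\<psi> (f x) = h x" if "x \<in> X" for x
    proof -
      have "f x \<in> carrier G" "h x \<in> carrier H" using f h that by auto
      then show ?thesis using \<psi>[of "[(x, True)]"] that by simp
    qed
  qed
qed

lemma (in group) word_value_power:
  assumes "f s \<in> carrier G" "f t \<in> carrier G"
  shows "word_value G f (concat (replicate n [(s, True), (t, True)])) = (f s \<otimes> f t) [^] n"
proof (induction n)
  case (Suc n)
  have "f s \<otimes> (f t \<otimes> (f s \<otimes> f t) [^] n) = (f s \<otimes> f t) [^] Suc n"
    unfolding nat_pow_Suc2[OF m_closed[OF assms]]
    using assms by (simp only: m_assoc nat_pow_closed m_closed)
  then show ?case using Suc by simp
qed simp

section \<open>Exchange and special subgroups in Coxeter groups\<close>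

lemma foldr_concat_replicate_append:
  "foldr act (concat (replicate (Suc n) us)) y = foldr act us (foldr act (concat (replicate n us)) y)"
  by simp

lemma (in group) conj_eq_iff:
  assumes "h \<in> carrier G" "x \<in> carrier G" "y \<in> carrier G"
  shows "h \<otimes> x \<otimes> inv h = y \<longleftrightarrow> x = inv h \<otimes> y \<otimes> h"
proof -
  have "h \<otimes> x \<otimes> inv h = y \<longleftrightarrow> h \<otimes> x = y \<otimes> h"
    using inv_solve_right'[of y "h \<otimes> x" h] assms by auto
  also have "\<dots> \<longleftrightarrow> x = inv h \<otimes> (y \<otimes> h)"
    using inv_solve_left[of x h "y \<otimes> h"] assms by auto
  finally show ?thesis using assms by (simp add: m_assoc)
qed

text \<open>When exchange deletes the letter \<open>t\<close> from a concatenation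
  \<open>a @ u\<close>, this tells which factor loses it.\<close>

lemma append_eq_append_Cons_cases:
  assumes "a @ u = p @ t # q"
  obtains q' where "a = p @ t # q'" "q = q' @ u" | p' where "p = a @ p'" "u = p' @ t # q"
  using assms by (auto simp: append_eq_append_conv2 Cons_eq_append_conv append_eq_Cons_conv)

section \<open>Words, length and parity\<close>

locale coxeter = group W for W :: "('a, 'b) monoid_scheme" (structure) +
  fixes S :: "'a set" and m :: "'a \<Rightarrow> 'a \<Rightarrow> enat"
  assumes coxeter_system: "coxeter_system W S m"
begin

lemma S_carrier: "S \<subseteq> carrier W"
  using coxeter_system by (simp add: coxeter_system_def)

lemma S_closed [simp]: "s \<in> S \<Longrightarrow> s \<in> carrier W"
  using S_carrier by blast

lemma m_props:
  assumes "s \<in> S" "t \<in> S"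
  shows "1 \<le> m s t" "m s t = m t s" "m s t = 1 \<longleftrightarrow> s = t"
  using coxeter_system assms by (auto simp: coxeter_system_def)

lemma presents_W: "presents W S (coxeter_relators S m) (\<lambda>s. s)"
  using coxeter_system by (auto simp: coxeter_system_def has_presentation_def presents_def)

lemma relator_words:
  "s \<in> S \<Longrightarrow> t \<in> S \<Longrightarrow> concat (replicate n [(s, True), (t, True)]) \<in> words S"
  by (induction n) auto

lemma pow_m:
  assumes "s \<in> S" "t \<in> S" "m s t < \<infinity>"
  shows "(s \<otimes> t) [^] the_enat (m s t) = \<one>"
proof -
  let ?r = "concat (replicate (the_enat (m s t)) [(s, True), (t, True)])"
  have r: "?r \<in> coxeter_relators S m" using assms by (auto simp: coxeter_relators_def)
  have w: "?r \<in> words S" using relator_words assms by blast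
  have "(?r, []) \<in> word_equiv S (coxeter_relators S m)"
    using word_equiv.relator[of "[]" S "[]" ?r, OF _ _ r w] by simp
  then have "word_value W (\<lambda>s. s) ?r = word_value W (\<lambda>s. s) []"
    using presents_W w unfolding presents_iff[OF is_group] by auto
  then show ?thesis using assms by (simp add: word_value_power)
qed

lemma S_square [simp]:
  assumes "s \<in> S"
  shows "s \<otimes> s = \<one>"
  using pow_m[OF assms assms] m_props(3)[OF assms assms] assms by (simp add: one_enat_def)

lemma S_inv [simp]: "s \<in> S \<Longrightarrow> inv s = s"
  by (rule inv_equality) auto

lemma S_cancel [simp]:
  assumes "s \<in> S" "g \<in> carrier W"
  shows "s \<otimes> (s \<otimes> g) = g" "g \<otimes> s \<otimes> s = g"
  using assms by (simp_all add: m_assoc[symmetric]) (simp add: m_assoc)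

definition val :: "'a list \<Rightarrow> 'a" where
  "val u = foldr (\<otimes>) u \<one>"

lemma val_simps [simp]: "val [] = \<one>" "val (s # u) = s \<otimes> val u"
  by (simp_all add: val_def)

lemma val_closed [simp]: "set u \<subseteq> S \<Longrightarrow> val u \<in> carrier W"
  by (induction u) auto

lemma val_append: "set u \<subseteq> S \<Longrightarrow> set v \<subseteq> S \<Longrightarrow> val (u @ v) = val u \<otimes> val v"
  by (induction u) (auto simp: m_assoc)

lemma val_snoc: "set u \<subseteq> S \<Longrightarrow> s \<in> S \<Longrightarrow> val (u @ [s]) = val u \<otimes> s"
  by (simp add: val_append)

text \<open>Generators are their own inverses, so the values of positive words already form a
  subgroup.\<close>

lemma generate_eq_val:
  assumes "T \<subseteq> S"
  shows "generate W T = val ` {u. set u \<subseteq> T}"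
proof
  show "generate W T \<subseteq> val ` {u. set u \<subseteq> T}"
  proof
    fix g assume "g \<in> generate W T"
    then show "g \<in> val ` {u. set u \<subseteq> T}"
    proof induction
      case one
      then show ?case by (intro image_eqI[of _ _ "[]"]) auto
    next
      case (incl h)
      then show ?case using assms by (intro image_eqI[of _ _ "[h]"]) auto
    next
      case (inv h)
      then show ?case using assms by (intro image_eqI[of _ _ "[h]"]) auto
    next
      case (eng g h)
      then obtain u v where "set u \<subseteq> T" "g = val u" "set v \<subseteq> T" "h = val v" by auto
      then show ?case using assms by (intro image_eqI[of _ _ "u @ v"]) (auto simp: val_append)
    qed
  qed
  have "val u \<in> generate W T" if "set u \<subseteq> T" for u
    using that by (induction u) (auto intro: generate.one generate.eng generate.incl)
  then show "val ` {u. set u \<subseteq> T} \<subseteq> generate W T" by auto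
qed

lemma carrier_eq_val: "carrier W = val ` {u. set u \<subseteq> S}"
  using coxeter_system generate_eq_val[of S] by (simp add: coxeter_system_def)

definition len :: "'a \<Rightarrow> nat" where
  "len g = (LEAST n. \<exists>u. set u \<subseteq> S \<and> val u = g \<and> length u = n)"

lemma len_val_le: "set u \<subseteq> S \<Longrightarrow> len (val u) \<le> length u"
  unfolding len_def by (rule Least_le) auto

lemma reduced_word:
  assumes "g \<in> carrier W"
  obtains u where "set u \<subseteq> S" "val u = g" "length u = len g"
proof -
  have "\<exists>n u. set u \<subseteq> S \<and> val u = g \<and> length u = n" using assms carrier_eq_val by auto
  from LeastI_ex[OF this] show thesis using that unfolding len_def by blast
qed

lemma len_one [simp]: "len \<one> = 0"
  using len_val_le[of "[]"] by simp

lemma len_mult_le: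
  assumes "g \<in> carrier W" "h \<in> carrier W"
  shows "len (g \<otimes> h) \<le> len g + len h"
proof -
  obtain u where "set u \<subseteq> S" "val u = g" "length u = len g" using reduced_word assms by blast
  moreover obtain v where "set v \<subseteq> S" "val v = h" "length v = len h"
    using reduced_word assms by blast
  ultimately show ?thesis using len_val_le[of "u @ v"] by (simp add: val_append)
qed

text \<open>The sign character: each generator acts on the truth values as negation, and relators
  have even length. Hence all words for one element, a shortest one included, have lengths of the
  same parity.\<close>

lemma even_len_val:
  assumes "set u \<subseteq> S"
  shows "even (len (val u)) \<longleftrightarrow> even (length u)"
proof -
  let ?act = "\<lambda>(s :: 'a, b :: bool). Not"
  have rel: "foldr ?act r y = y" if r: "r \<in> coxeter_relators S m" for r y
  proof -
    have "foldr ?act (concat (replicate n [(s, True), (t, True)])) y = y" for n s t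
      by (induction n) auto
    then show ?thesis using r by (auto simp: coxeter_relators_def)
  qed
  have cl: "?act (x, b) y \<in> UNIV" and inv: "?act (x, b) (?act (x, \<not> b) y) = y" for x b y
    by simp_all
  obtain F where F: "\<And>y. y \<in> UNIV \<Longrightarrow> F \<one> y = y"
      "\<And>g h y. g \<in> carrier W \<Longrightarrow> h \<in> carrier W \<Longrightarrow> y \<in> UNIV \<Longrightarrow> F (g \<otimes> h) y = F g (F h y)"
      "\<And>x y. x \<in> S \<Longrightarrow> y \<in> UNIV \<Longrightarrow> F x y = ?act (x, True) y"
    by (rule presents_action[of W S _ "\<lambda>s. s" UNIV ?act, OF is_group presents_W cl inv rel]) blast+
  have *: "F (val u) True \<longleftrightarrow> even (length u)" if "set u \<subseteq> S" for u
    using that by (induction u) (auto simp: F)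
  obtain v where v: "set v \<subseteq> S" "val v = val u" "length v = len (val u)"
    using reduced_word assms val_closed by metis
  show ?thesis using *[OF assms] *[OF v(1)] v by simp
qed

text \<open>The triangle inequality bounds the change by one, and parity excludes no change.\<close>

lemma len_mult_S:
  assumes "g \<in> carrier W" "s \<in> S"
  shows "len (g \<otimes> s) = len g + 1 \<or> len g = len (g \<otimes> s) + 1"
proof -
  obtain u where u: "set u \<subseteq> S" "val u = g" "length u = len g" using reduced_word assms by blast
  have le1: "len s \<le> 1" using len_val_le[of "[s]"] assms by simp
  have "len (g \<otimes> s) \<le> len g + 1"
    using len_mult_le[of g s] assms le1 by simp
  moreover have "len g \<le> len (g \<otimes> s) + 1"
    using len_mult_le[of "g \<otimes> s" s] assms le1 by simp
  moreover have "even (len (g \<otimes> s)) \<longleftrightarrow> \<not> even (len g)"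
    using even_len_val[of "u @ [s]"] u assms by (simp add: val_snoc)
  ultimately show ?thesis by presburger
qed

lemma len_S [simp]: "s \<in> S \<Longrightarrow> len s = 1"
  using len_mult_S[of \<one> s] by simp

section \<open>The cocycle of Tits and the exchange condition\<close>

lemma conj_pow:
  assumes "s \<in> S" "t \<in> S"
  shows "(s \<otimes> t) [^] (n::nat) \<otimes> t \<otimes> (s \<otimes> t) [^] n = t"
proof (induction n)
  case 0
  then show ?case using assms by simp
next
  case (Suc n)
  let ?g = "s \<otimes> t"
  have g: "?g \<in> carrier W" using assms by simp
  \<comment> \<open>\<open>t\<close> inverts \<open>s \<otimes> t\<close>, so the innermost block
    collapses to \<open>t\<close> and the induction hypothesis applies.\<close>
  have "?g \<otimes> t \<otimes> ?g = t" using assms by (simp add: m_assoc)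
  then have "?g [^] n \<otimes> (?g \<otimes> t \<otimes> ?g) \<otimes> ?g [^] n = t" using Suc by simp
  then show ?case
    using g assms(2) by (subst (2) nat_pow_Suc2) (simp_all only: nat_pow_Suc m_assoc m_closed nat_pow_closed S_closed)
qed

text \<open>The cocycle of Tits: the word \<open>u\<close> acts on \<open>(r, False)\<close> by conjugating \<open>r\<close> and recording the parity
  of the number of suffixes \<open>s # q\<close> of \<open>u\<close> with \<open>q r q\<^sup>-\<^sup>1 = s\<close>. That a relator \<open>(st)\<^sup>k\<close> acts trivially
  is the observation that the list \<open>t (st)\<^sup>j\<close>, \<open>j < 2k\<close>, runs twice through the same \<open>k\<close> elements.\<close>

definition tits_act :: "'a \<times> bool \<Rightarrow> 'a \<times> bool \<Rightarrow> 'a \<times> bool" where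
  "tits_act = (\<lambda>(s, b) (r, e). (s \<otimes> r \<otimes> s, e \<noteq> (r = s)))"

text \<open>Counted from the right and from 0, letter number \<open>j\<close> flips the bit exactly
  when \<open>r = t \<otimes> (s \<otimes> t) [^] j\<close>. In the induction the new block adds the
  index \<open>2 * n\<close> for \<open>t\<close> and \<open>2 * n + 1\<close> for
  \<open>s\<close>.\<close>

lemma foldr_tits_act_power:
  assumes s: "s \<in> S" and t: "t \<in> S" and r: "r \<in> carrier W"
  shows "foldr tits_act (concat (replicate n [(s, True), (t, True)])) (r, e) =
    ((s \<otimes> t) [^] n \<otimes> r \<otimes> inv ((s \<otimes> t) [^] n),
     e \<noteq> odd (card {j. j < 2 * n \<and> r = t \<otimes> (s \<otimes> t) [^] j}))"
proof (induction n)
  case 0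
  then show ?case using r by simp
next
  case (Suc n)
  define g where "g = s \<otimes> t"
  have g [simp]: "g \<in> carrier W" using s t by (simp add: g_def)
  have inv_g: "inv g = t \<otimes> s" using s t by (simp add: g_def inv_mult_group)
  define r' where "r' = g [^] n \<otimes> r \<otimes> inv (g [^] n)"
  have r' [simp]: "r' \<in> carrier W" using r by (simp add: r'_def)
  have conj: "g [^] n \<otimes> t \<otimes> g [^] n = t"
    using conj_pow[OF s t] by (simp add: g_def)
  have inv_t: "inv (g [^] n) \<otimes> t = t \<otimes> g [^] n"
    using conj t inv_solve_left[of "t \<otimes> g [^] n" "g [^] n" t] by (simp add: m_assoc)
  have eq1: "r' = t \<longleftrightarrow> r = t \<otimes> g [^] (2 * n)"
  proof -
    have "r' = t \<longleftrightarrow> r = inv (g [^] n) \<otimes> t \<otimes> g [^] n"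
      using r t conj_eq_iff[of "g [^] n" r] by (simp add: r'_def)
    then show ?thesis using t by (simp add: inv_t m_assoc nat_pow_mult mult_2)
  qed
  have eq2: "t \<otimes> r' \<otimes> t = s \<longleftrightarrow> r = t \<otimes> g [^] (2 * n + 1)"
  proof -
    have "t \<otimes> r' \<otimes> t = s \<longleftrightarrow> r' = t \<otimes> g"
      using s t conj_eq_iff[of t r' s] by (simp add: g_def m_assoc)
    also have "\<dots> \<longleftrightarrow> r = inv (g [^] n) \<otimes> (t \<otimes> g) \<otimes> g [^] n"
      using r t conj_eq_iff[of "g [^] n" r] by (simp add: r'_def)
    also have "inv (g [^] n) \<otimes> (t \<otimes> g) \<otimes> g [^] n = (inv (g [^] n) \<otimes> t) \<otimes> (g \<otimes> g [^] n)"
      using t by (simp add: m_assoc)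
    also have "\<dots> = t \<otimes> (g [^] n \<otimes> (g [^] (1::nat) \<otimes> g [^] n))"
      using t by (simp add: inv_t m_assoc)
    also have "\<dots> = t \<otimes> g [^] (2 * n + 1)"
      by (simp only: nat_pow_mult[OF g]) (simp add: mult_2)
    finally show ?thesis .
  qed
  let ?J = "\<lambda>k. {j. j < k \<and> r = t \<otimes> g [^] j}"
  have step: "odd (card (?J (Suc k))) = (odd (card (?J k)) \<noteq> (r = t \<otimes> g [^] k))" for k
  proof -
    have "?J (Suc k) = (if r = t \<otimes> g [^] k then insert k (?J k) else ?J k)"
      by (auto simp: less_Suc_eq)
    then show ?thesis by simp
  qed
  have "foldr tits_act (concat (replicate (Suc n) [(s, True), (t, True)])) (r, e) =
      tits_act (s, True) (tits_act (t, True) (r', e \<noteq> odd (card (?J (2 * n)))))"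
    using Suc.IH unfolding foldr_concat_replicate_append by (simp add: g_def r'_def)
  also have "\<dots> = (s \<otimes> (t \<otimes> r' \<otimes> t) \<otimes> s,
      e \<noteq> ((odd (card (?J (2 * n))) \<noteq> (r' = t)) \<noteq> (t \<otimes> r' \<otimes> t = s)))"
    by (auto simp: tits_act_def)
  also have "s \<otimes> (t \<otimes> r' \<otimes> t) \<otimes> s = g \<otimes> r' \<otimes> inv g"
    using s t by (simp add: inv_g) (simp add: g_def m_assoc)
  also have "\<dots> = g [^] Suc n \<otimes> r \<otimes> inv (g [^] Suc n)"
    unfolding nat_pow_Suc2[OF g] using r
    by (simp only: r'_def inv_mult_group m_assoc m_closed inv_closed nat_pow_closed g)
  also have "((odd (card (?J (2 * n))) \<noteq> (r' = t)) \<noteq> (t \<otimes> r' \<otimes> t = s)) =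
      odd (card (?J (2 * Suc n)))"
    using step[of "2 * n"] step[of "Suc (2 * n)"] by (simp only: eq1 eq2 mult_Suc_right add_2_eq_Suc Suc_eq_plus1[symmetric])
  finally show ?case by (simp add: g_def)
qed

lemma foldr_tits_act_relator:
  assumes "w \<in> coxeter_relators S m" "y \<in> carrier W \<times> UNIV"
  shows "foldr tits_act w y = y"
proof -
  obtain s t where st: "s \<in> S" "t \<in> S" "m s t < \<infinity>"
    and w: "w = concat (replicate (the_enat (m s t)) [(s, True), (t, True)])"
    using assms(1) by (auto simp: coxeter_relators_def)
  obtain r e where y: "y = (r, e)" "r \<in> carrier W" using assms(2) by auto
  define k where "k = the_enat (m s t)"
  define g where "g = s \<otimes> t"
  have g: "g \<in> carrier W" "g [^] k = \<one>"
    using st pow_m by (auto simp: k_def g_def)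
  have shift: "g [^] (j + k) = g [^] j" for j
    using g by (simp add: nat_pow_mult[symmetric])
  let ?J = "{j. j < k \<and> r = t \<otimes> g [^] j}"
  \<comment> \<open>As \<open>g [^] k = \<one>\<close>, shifting by \<open>k\<close> matches the
    hits in the two halves of the index range, so their number is even.\<close>
  have "{j. j < 2 * k \<and> r = t \<otimes> g [^] j} = ?J \<union> (\<lambda>j. j + k) ` ?J" (is "?L = ?R")
  proof
    show "?R \<subseteq> ?L" using shift by auto
    show "?L \<subseteq> ?R"
    proof
      fix j assume j: "j \<in> ?L"
      show "j \<in> ?R"
      proof (cases "j < k")
        case False
        then have "j = (j - k) + k" "j - k < k" using j by auto
        then show ?thesis using j shift[of "j - k"] by (intro UnI2 image_eqI[of _ _ "j - k"]) auto
      qed (use j in auto)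
    qed
  qed
  moreover have "card (?J \<union> (\<lambda>j. j + k) ` ?J) = card ?J + card ?J"
    by (subst card_Un_disjoint) (auto simp: card_image)
  ultimately have "even (card {j. j < 2 * k \<and> r = t \<otimes> g [^] j})" by simp
  then show ?thesis
    using foldr_tits_act_power[OF st(1,2) y(2), of k e] g y
    by (simp add: w y(1) k_def[symmetric] g_def[symmetric])
qed

text \<open>Whether the recorded parity of \<open>s\<close> is odd depends only on the element \<open>val u\<close>, while a letter to delete
  can then be found in every word for it. So \<open>u\<close> need not be reduced.\<close>

lemma exchange:
  assumes u: "set u \<subseteq> S" and s: "s \<in> S" and less: "len (val u \<otimes> s) < len (val u)"
  obtains p t q where "u = p @ t # q" "val u \<otimes> s = val (p @ q)"
proof -
  have inv: "tits_act (x, b) (tits_act (x, \<not> b) y) = y" if "x \<in> S" "y \<in> carrier W \<times> UNIV" for x b y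
  proof -
    from that(2) obtain r e where y: "y = (r, e)" "r \<in> carrier W" by auto
    have "x \<otimes> r \<otimes> x = x \<longleftrightarrow> r = x"
      using that(1) y(2) conj_eq_iff[of x r x] by (simp add: m_assoc)
    then show ?thesis using that(1) y by (auto simp: tits_act_def m_assoc)
  qed
  have cl: "tits_act (x, b) y \<in> carrier W \<times> UNIV" if "x \<in> S" "y \<in> carrier W \<times> UNIV" for x b y
    using that by (auto simp: tits_act_def)
  obtain F where F: "\<And>y. y \<in> carrier W \<times> UNIV \<Longrightarrow> F \<one> y = y"
      "\<And>g h y. g \<in> carrier W \<Longrightarrow> h \<in> carrier W \<Longrightarrow> y \<in> carrier W \<times> UNIV \<Longrightarrow>
        F (g \<otimes> h) y = F g (F h y)"
      "\<And>s y. s \<in> S \<Longrightarrow> y \<in> carrier W \<times> UNIV \<Longrightarrow> F s y = tits_act (s, True) y"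
    by (rule presents_action[of W S _ "\<lambda>s. s" "carrier W \<times> UNIV" tits_act, OF is_group presents_W
          cl inv foldr_tits_act_relator]) (assumption+, blast)
  have step: "F (val (x # v)) (r, e) = tits_act (x, True) (F (val v) (r, e))"
    and fst_F: "fst (F (val v) (r, e)) = val v \<otimes> r \<otimes> inv (val v)"
    if "x \<in> S" "set v \<subseteq> S" "r \<in> carrier W" for x v r e
  proof -
    have "fst (F (val v) (r, e)) = val v \<otimes> r \<otimes> inv (val v) \<and>
      (\<forall>x\<in>S. F (val (x # v)) (r, e) = tits_act (x, True) (F (val v) (r, e)))"
      using that(2)
    proof (induction v)
      case Nil
      then show ?case using that(3) by (simp add: F)
    next
      case (Cons y v)
      then have y: "y \<in> S" and v: "set v \<subseteq> S" by auto
      have 1: "F (val (y # v)) (r, e) = tits_act (y, True) (F (val v) (r, e))"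
        and 2: "fst (F (val v) (r, e)) = val v \<otimes> r \<otimes> inv (val v)"
        using Cons.IH[OF v] y by auto
      obtain r' e' where F': "F (val v) (r, e) = (r', e')" by (cases "F (val v) (r, e)")
      have r': "r' = val v \<otimes> r \<otimes> inv (val v)" "r' \<in> carrier W" using 2 F' v that(3) by auto
      have 3: "F (val (y # v)) (r, e) = (y \<otimes> r' \<otimes> y, e' \<noteq> (r' = y))"
        using 1 F' by (simp add: tits_act_def)
      have "y \<otimes> r' \<otimes> y = val (y # v) \<otimes> r \<otimes> inv (val (y # v))"
        using y v that(3) by (simp add: r'(1) m_assoc inv_mult_group)
      moreover have "F (val (x # y # v)) (r, e) = tits_act (x, True) (F (val (y # v)) (r, e))"
        if "x \<in> S" for x
      proof -
        have "F (val (x # y # v)) (r, e) = F x (F (val (y # v)) (r, e))"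
          using F(2)[of x "val (y # v)" "(r, e)"] that y v \<open>r \<in> carrier W\<close> by simp
        also have "\<dots> = tits_act (x, True) (F (val (y # v)) (r, e))"
          using that y r' by (subst F(3)) (auto simp: 3 simp del: val_simps)
        finally show ?thesis .
      qed
      ultimately show ?case using 3 by simp
    qed
    then show "F (val (x # v)) (r, e) = tits_act (x, True) (F (val v) (r, e))"
        "fst (F (val v) (r, e)) = val v \<otimes> r \<otimes> inv (val v)"
      using that(1) by auto
  qed
  \<comment> \<open>A changed bit was flipped at some letter \<open>x\<close> in front of a suffix
    \<open>v\<close>, where \<open>val v \<otimes> r \<otimes> inv (val v) = x\<close>. Hence
    deleting \<open>x\<close> amounts to multiplying by \<open>r\<close> on the right.\<close>
  have del: "\<exists>p t q. v = p @ t # q \<and> val v \<otimes> r = val (p @ q)"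
    if "set v \<subseteq> S" "r \<in> carrier W" "snd (F (val v) (r, e)) \<noteq> e" for v r e
    using that(1,3)
  proof (induction v)
    case Nil
    then show ?case using that(2) by (simp add: F)
  next
    case (Cons x v)
    then have x: "x \<in> S" and v: "set v \<subseteq> S" by auto
    obtain r' e' where F': "F (val v) (r, e) = (r', e')" by (cases "F (val v) (r, e)")
    have r': "r' = val v \<otimes> r \<otimes> inv (val v)" using fst_F[OF x v that(2), of e] F' by simp
    have "snd (F (val (x # v)) (r, e)) = (e' \<noteq> (r' = x))"
      using step[OF x v that(2), of e] F' by (simp add: tits_act_def)
    then consider "e' \<noteq> e" | "r' = x" using Cons.prems(2) by auto
    then show ?case
    proof cases
      case 1
      then obtain p t q where pq: "v = p @ t # q" "val v \<otimes> r = val (p @ q)"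
        using Cons.IH v F' by auto
      have "val (x # v) \<otimes> r = val ((x # p) @ q)"
        using x v that(2) pq(2) by (simp add: m_assoc)
      then show ?thesis using pq(1) by (intro exI[of _ "x # p"]) auto
    next
      case 2
      then have "x \<otimes> val v = val v \<otimes> r"
        using r' x v that(2) inv_solve_right[of x "val v \<otimes> r" "val v"] by simp
      moreover have "val (x # v) \<otimes> r = x \<otimes> (val v \<otimes> r)"
        using x v that(2) by (simp add: m_assoc)
      ultimately have "val (x # v) \<otimes> r = x \<otimes> (x \<otimes> val v)" by simp
      then have "val (x # v) \<otimes> r = val ([] @ v)" using x v by simp
      then show ?thesis by blast
    qed
  qed
  \<comment> \<open>The initial bit is only ever negated, never inspected, so negating it negates
    the result.\<close>
  have flip: "snd (F (val v) (r, \<not> e)) \<longleftrightarrow> \<not> snd (F (val v) (r, e))"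
    if "set v \<subseteq> S" "r \<in> carrier W" for v r e
    using that(1)
  proof (induction v)
    case Nil
    then show ?case using that(2) by (simp add: F)
  next
    case (Cons x v)
    then have x: "x \<in> S" and v: "set v \<subseteq> S" by auto
    have "fst (F (val v) (r, \<not> e)) = fst (F (val v) (r, e))"
      using fst_F[OF x v that(2)] by metis
    moreover have "snd (F (val v) (r, \<not> e)) \<longleftrightarrow> \<not> snd (F (val v) (r, e))"
      using Cons.IH v by blast
    ultimately show ?case
      unfolding step[OF x v that(2)] by (simp add: tits_act_def split_beta)
  qed
  \<comment> \<open>If the bit stayed \<open>False\<close>, a shortest word for
    \<open>val u \<otimes> s\<close> would change it, since \<open>s\<close> itself flips the bit
    once. Deleting a letter from that word would give a word for \<open>val u\<close> of length
    below \<open>len (val u \<otimes> s)\<close>, against \<open>less\<close>.\<close>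
  have "snd (F (val u) (s, False))"
  proof (rule ccontr)
    assume neg: "\<not> snd (F (val u) (s, False))"
    obtain v where v: "set v \<subseteq> S" "val v = val u \<otimes> s" "length v = len (val u \<otimes> s)"
      using reduced_word[of "val u \<otimes> s"] u s by auto
    have "F (val v) (s, False) = F (val u) (s, True)"
      using u s F(2)[of "val u" s "(s, False)"] F(3)[of s "(s, False)"] by (simp add: v tits_act_def)
    then have "snd (F (val v) (s, False)) \<noteq> False"
      using flip[OF u, of s False] neg s by simp
    from del[OF v(1) S_closed[OF s] this]
    obtain p t q where pq: "v = p @ t # q" "val v \<otimes> s = val (p @ q)" by blast
    have "len (val u) \<le> length (p @ q)"
      using len_val_le[of "p @ q"] pq v(1,2) u s by simp
    then show False using pq(1) v(3) less by simp
  qed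
  then have "snd (F (val u) (s, False)) \<noteq> False" by simp
  from del[OF u S_closed[OF s] this] show thesis using that by blast
qed

section \<open>Reduced words in special subgroups and their cosets\<close>

lemma reduced_word_in:
  assumes "T \<subseteq> S" "g \<in> generate W T"
  obtains u where "set u \<subseteq> T" "val u = g" "length u = len g"
proof -
  have "\<exists>v. set v \<subseteq> T \<and> val v = val u \<and> length v = len (val u)" if "set u \<subseteq> T" for u
    using that
  proof (induction u rule: rev_induct)
    case Nil
    then show ?case by (intro exI[of _ "[]"]) simp
  next
    case (snoc s u)
    then have s: "s \<in> T" "s \<in> S" and u: "set u \<subseteq> S" using assms(1) by auto
    obtain v where v: "set v \<subseteq> T" "val v = val u" "length v = len (val u)" using snoc by auto
    have vS: "set v \<subseteq> S" using v(1) assms(1) by auto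
    have val: "val (u @ [s]) = val u \<otimes> s" "val (v @ [s]) = val u \<otimes> s"
      using u vS s(2) v(2) by (simp_all add: val_snoc)
    consider "len (val u \<otimes> s) = len (val u) + 1" | "len (val u) = len (val u \<otimes> s) + 1"
      using len_mult_S[of "val u" s] u s(2) by auto
    then show ?case
    proof cases
      case 1
      then show ?thesis using v s val by (intro exI[of _ "v @ [s]"]) simp
    next
      case 2
      \<comment> \<open>Exchange deletes a letter and introduces none, so the shortened word is
        still over \<open>T\<close>.\<close>
      then have "len (val v \<otimes> s) < len (val v)" using v(2) by simp
      then obtain p t q where pq: "v = p @ t # q" "val v \<otimes> s = val (p @ q)"
        using exchange[OF vS s(2)] by blast
      then show ?thesis using 2 v val by (intro exI[of _ "p @ q"]) auto
    qed
  qed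
  then show thesis using assms that by (auto simp: generate_eq_val)
qed

text \<open>A reduced word over \<open>T\<close> for \<open>s\<close> has a single letter. This
  later tells the factors of a splitting from the amalgamated subgroup.\<close>

lemma S_in_generate:
  assumes "T \<subseteq> S" "s \<in> S" "s \<in> generate W T"
  shows "s \<in> T"
proof -
  obtain u where u: "set u \<subseteq> T" "val u = s" "length u = 1"
    using reduced_word_in[OF assms(1,3)] assms(2) by auto
  then obtain t where "u = [t]" by (metis One_nat_def length_0_conv length_Suc_conv)
  then show ?thesis using u assms(1) by auto
qed

text \<open>If appending \<open>s\<close> to a reduced word for \<open>w \<otimes> val u\<close>
  lowered the length, exchange would delete a letter. Deletion from the part for \<open>w\<close>
  yields a shorter element of the coset; deletion from \<open>u\<close> contradicts that
  \<open>u @ [s]\<close> is reduced.\<close>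

lemma len_mult_minimal:
  assumes T: "T \<subseteq> S" and w: "w \<in> carrier W"
    and min: "\<And>v. v \<in> generate W T \<Longrightarrow> len w \<le> len (w \<otimes> v)"
    and v: "v \<in> generate W T"
  shows "len (w \<otimes> v) = len w + len v"
proof -
  have "len (w \<otimes> val u) = len w + length u" if "set u \<subseteq> T" "length u = len (val u)" for u
    using that
  proof (induction u rule: rev_induct)
    case Nil
    then show ?case using w by simp
  next
    case (snoc s u)
    then have s: "s \<in> T" "s \<in> S" and u: "set u \<subseteq> T" "set u \<subseteq> S" using T by auto
    have val: "val (u @ [s]) = val u \<otimes> s" using u s by (simp add: val_snoc)
    have lu: "length u = len (val u)"
      using snoc.prems(2) len_val_le[OF u(2)] len_mult_S[of "val u" s] u(2) s(2) val by auto
    have IH: "len (w \<otimes> val u) = len w + length u" by (rule snoc.IH[OF u(1) lu])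
    have "\<not> len (w \<otimes> val u \<otimes> s) < len (w \<otimes> val u)"
    proof
      assume less: "len (w \<otimes> val u \<otimes> s) < len (w \<otimes> val u)"
      obtain x where x: "set x \<subseteq> S" "val x = w" "length x = len w" using reduced_word w by blast
      have xu: "set (x @ u) \<subseteq> S" "val (x @ u) = w \<otimes> val u" using x u by (simp_all add: val_append)
      obtain p t q where pq: "x @ u = p @ t # q" "w \<otimes> val u \<otimes> s = val (p @ q)"
        using exchange[OF xu(1) s(2)] less xu(2) by metis
      show False
        using pq(1)
      proof (cases rule: append_eq_append_Cons_cases)
        case (1 q')
        note x_eq = 1(1) and q = 1(2)
        have sets: "set p \<subseteq> S" "set q' \<subseteq> S" using x(1) x_eq by auto
        then have "w \<otimes> val u \<otimes> s = val (p @ q') \<otimes> val u"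
          using pq(2) q u(2) by (simp add: val_append m_assoc)
        then have "val (p @ q') = w \<otimes> (val u \<otimes> s \<otimes> inv (val u))"
          using w u(2) s(2) sets by (simp add: inv_solve_right m_assoc[symmetric])
        moreover have "val u \<otimes> s \<otimes> inv (val u) \<in> generate W T"
          using u(1) s(1) generate_eq_val[OF T] T
          by (metis (no_types, lifting) S_carrier generate.eng generate.incl generate_m_inv_closed image_eqI 
              mem_Collect_eq subset_trans)
        ultimately have "len w \<le> len (val (p @ q'))" using min by simp
        also have "\<dots> \<le> length (p @ q')" using sets by (intro len_val_le) simp
        finally show False using x(3) x_eq by simp
      next
        case (2 p')
        note p = 2(1) and u_eq = 2(2)
        have sets: "set p' \<subseteq> S" "set q \<subseteq> S" using u(2) u_eq by auto
        have "w \<otimes> (val u \<otimes> s) = w \<otimes> val (p' @ q)"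
          using pq(2) p w x u(2) s(2) sets by (simp add: val_append m_assoc)
        then have "val (u @ [s]) = val (p' @ q)"
          using val w u(2) s(2) sets by simp
        then have "len (val (u @ [s])) \<le> length (p' @ q)"
          using len_val_le[of "p' @ q"] sets by simp
        then show False using snoc.prems(2) u_eq by simp
      qed
    qed
    then show ?case
      using len_mult_S[of "w \<otimes> val u" s] IH val w u(2) s(2) by (simp add: m_assoc)
  qed
  then show ?thesis using reduced_word_in[OF T v] by metis
qed

text \<open>Minimality in the coset can be tested on \<open>T\<close> alone: write
  \<open>w = w0 \<otimes> inv x\<close> with \<open>w0\<close> shortest in the coset; the last
  letter of a nonempty reduced word for \<open>inv x\<close> would be a descent of \<open>w\<close>
  in \<open>T\<close>.\<close>

lemma len_mult_special:
  assumes T: "T \<subseteq> S" and w: "w \<in> carrier W" and asc: "\<And>s. s \<in> T \<Longrightarrow> len w < len (w \<otimes> s)"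
    and v: "v \<in> generate W T"
  shows "len (w \<otimes> v) = len w + len v"
proof -
  have sub: "subgroup (generate W T) W" using T S_carrier by (intro generate_is_subgroup) auto
  have gcl: "g \<in> carrier W" if "g \<in> generate W T" for g using that sub subgroup.mem_carrier by metis
  obtain x where x: "x \<in> generate W T"
    and min: "\<And>y. y \<in> generate W T \<Longrightarrow> len (w \<otimes> x) \<le> len (w \<otimes> y)"
    using ex_has_least_nat[of "\<lambda>y. y \<in> generate W T" \<one> "\<lambda>y. len (w \<otimes> y)"] generate.one by blast
  define w0 where "w0 = w \<otimes> x"
  have w0: "w0 \<in> carrier W" "w = w0 \<otimes> inv x" using w x gcl by (simp_all add: w0_def m_assoc)
  have min0: "len w0 \<le> len (w0 \<otimes> y)" if "y \<in> generate W T" for y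
    using min[of "x \<otimes> y"] that x w gcl by (simp add: w0_def m_assoc generate.eng)
  have add: "len (w0 \<otimes> y) = len w0 + len y" if "y \<in> generate W T" for y
    using len_mult_minimal[OF T w0(1) min0 that] .
  have ix: "inv x \<in> generate W T" using sub x by (simp add: subgroup.m_inv_closed)
  obtain u where u: "set u \<subseteq> T" "val u = inv x" "length u = len (inv x)"
    using reduced_word_in[OF T ix] .
  have "u = []"
  proof (cases u rule: rev_cases)
    case (snoc y s)
    then have s: "s \<in> T" "s \<in> S" and y: "set y \<subseteq> S" "set y \<subseteq> T" using u(1) T by auto
    have xs: "inv x \<otimes> s = val y"
      using u(2) y(1) s(2) snoc by (metis S_cancel(2) val_closed val_snoc)
    then have "w \<otimes> s = w0 \<otimes> val y" using w0 x s(2) gcl by (simp add: m_assoc)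
    moreover have "val y \<in> generate W T" using y generate_eq_val[OF T] by auto
    ultimately have "len (w \<otimes> s) = len w0 + len (val y)" using add by simp
    also have "\<dots> \<le> len w0 + length y" using len_val_le[OF y(1)] by simp
    also have "\<dots> < len w0 + len (inv x)" using u(3) snoc by simp
    also have "\<dots> = len w" using add[OF ix] w0(2) by simp
    finally show ?thesis using asc[OF s(1)] by simp
  qed simp
  then have "w = w0" using u(2) w0 by (metis r_one val_simps(1))
  then show ?thesis using add[OF v] by simp
qed

lemma finite_len_le:
  assumes "finite S"
  shows "finite {g \<in> carrier W. len g \<le> n}"
proof -
  have "{g \<in> carrier W. len g \<le> n} \<subseteq> val ` {u. set u \<subseteq> S \<and> length u \<le> n}"
  proof
    fix g assume g: "g \<in> {g \<in> carrier W. len g \<le> n}"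
    then obtain u where "set u \<subseteq> S" "val u = g" "length u = len g" using reduced_word by blast
    then show "g \<in> val ` {u. set u \<subseteq> S \<and> length u \<le> n}" using g by auto
  qed
  from finite_subset[OF this finite_imageI[OF finite_lists_length_le[OF assms]]] show ?thesis .
qed

text \<open>Every reduced word over \<open>T\<close> is a suffix of a reduced word for
  \<open>w\<close>, so its length is at most \<open>len w\<close>. To append a further descent
  \<open>s\<close> to the suffix \<open>u\<close>, exchange removes a letter; it cannot come from
  \<open>u\<close>, as \<open>u @ [s]\<close> is reduced, so the prefix pays for
  \<open>s\<close>.\<close>

lemma finite_generate_descents:
  assumes "finite S" and T: "T \<subseteq> S" and w: "w \<in> carrier W"
    and desc: "\<And>s. s \<in> T \<Longrightarrow> len (w \<otimes> s) < len w"
  shows "finite (generate W T)"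
proof -
  have suffix: "\<exists>a. set a \<subseteq> S \<and> val (a @ u) = w \<and> length (a @ u) = len w"
    if "set u \<subseteq> T" "length u = len (val u)" for u
    using that
  proof (induction u rule: rev_induct)
    case Nil
    then show ?case using reduced_word[OF w] by (metis append_Nil2)
  next
    case (snoc s u)
    then have s: "s \<in> T" "s \<in> S" and u: "set u \<subseteq> T" "set u \<subseteq> S" using T by auto
    have val: "val (u @ [s]) = val u \<otimes> s" using u s by (simp add: val_snoc)
    have lu: "length u = len (val u)"
      using snoc.prems(2) len_val_le[OF u(2)] len_mult_S[of "val u" s] u(2) s(2) val by auto
    obtain a where a: "set a \<subseteq> S" "val (a @ u) = w" "length (a @ u) = len w"
      using snoc.IH[OF u(1) lu] by blast
    have au: "set (a @ u) \<subseteq> S" using a u by auto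
    obtain p t q where pq: "a @ u = p @ t # q" "w \<otimes> s = val (p @ q)"
      using exchange[OF au s(2)] desc[OF s(1)] a(2) by metis
    show ?case
      using pq(1)
    proof (cases rule: append_eq_append_Cons_cases)
      case (1 q')
      note a_eq = 1(1) and q = 1(2)
      have sets: "set p \<subseteq> S" "set q' \<subseteq> S" using a(1) a_eq by auto
      have "w = val (p @ q) \<otimes> s" using pq(2) w s(2) by (metis S_cancel(2))
      also have "\<dots> = val ((p @ q') @ u @ [s])"
        using q sets u(2) s(2) by (simp add: val_append m_assoc)
      finally show ?thesis
        using a(3) a_eq sets by (intro exI[of _ "p @ q'"]) simp
    next
      case (2 p')
      note p = 2(1) and u_eq = 2(2)
      have sets: "set p' \<subseteq> S" "set q \<subseteq> S" using u(2) u_eq by auto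
      have "val a \<otimes> (val u \<otimes> s) = val a \<otimes> val (p' @ q)"
        using pq(2) p a u(2) s(2) sets by (auto simp add: val_append m_assoc)
      then have "val (u @ [s]) = val (p' @ q)"
        using val a(1) u(2) s(2) sets by simp
      then have "len (val (u @ [s])) \<le> length (p' @ q)"
        using len_val_le[of "p' @ q"] sets by simp
      then show ?thesis using snoc.prems(2) u_eq by simp
    qed
  qed
  have "generate W T \<subseteq> {g \<in> carrier W. len g \<le> len w}"
  proof
    fix g assume g: "g \<in> generate W T"
    obtain u where u: "set u \<subseteq> T" "val u = g" "length u = len g" using reduced_word_in[OF T g] .
    then have "len g \<le> len w" using suffix[of u] by fastforce
    moreover have "g \<in> carrier W" using u T by auto
    ultimately show "g \<in> {g \<in> carrier W. len g \<le> len w}" by simp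
  qed
  then show ?thesis using finite_len_le[OF assms(1)] finite_subset by blast
qed

end

section \<open>Normal forms in amalgamated products\<close>

lemma decomposes_as_amalgam_iff:
  "decomposes_as_amalgam W A C B \<longleftrightarrow>
    subgroup A W \<and> subgroup B W \<and> subgroup C W \<and> C \<subseteq> A \<and> C \<subseteq> B \<and>
    presents W (A <+> B)
      (amalgam_relators (W\<lparr>carrier := A\<rparr>) (W\<lparr>carrier := B\<rparr>) (W\<lparr>carrier := C\<rparr>) id id)
      (case_sum (\<lambda>a. a) (\<lambda>b. b))"
  unfolding decomposes_as_amalgam_def presents_def Let_def amalgam_def amalgam_gen_def
  by (simp add: Plus_def ball_Un)

lemma amalgam_generate:
  assumes "group W" "decomposes_as_amalgam W A C B"
  shows "generate W (A \<union> B) = carrier W"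
proof -
  have "case_sum (\<lambda>a. a) (\<lambda>b. b) ` (A <+> B) = A \<union> B"
    by (auto simp: Plus_def image_Un image_image)
  then show ?thesis
    using presents_generate[OF assms(1)] assms(2) by (metis decomposes_as_amalgam_iff)
qed

text \<open>Left multiplication by the generators of the group \<open>\<langle>x : x\<^sup>2 = 1\<rangle>\<close> on its normal forms, the lists
  without equal neighbours.\<close>

fun push :: "'x \<Rightarrow> 'x list \<Rightarrow> 'x list" where
  "push d [] = [d]"
| "push d (e # l) = (if d = e then l else d # e # l)"

lemma push_push: "distinct_adj l \<Longrightarrow> push d (push d l) = l"
proof (cases l)
  case (Cons e l')
  moreover assume "distinct_adj l"
  ultimately show ?thesis by (cases l') auto
qed simp

lemma distinct_adj_push: "distinct_adj l \<Longrightarrow> distinct_adj (push d l)"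
  by (cases l) (auto simp: distinct_adj_Cons)

text \<open>The last entry changes only when \<open>d\<close> fills an empty list or cancels a
  singleton. Taken with \<open>c = C\<close>, this keeps a set of normal forms almost invariant
  later.\<close>

lemma last_push: "d \<noteq> c \<Longrightarrow> push d l \<noteq> [] \<and> last (push d l) = c \<longleftrightarrow> l \<noteq> [] \<and> last l = c"
  by (cases l) auto

lemma push_Cons_eq: "l \<noteq> [] \<Longrightarrow> hd l \<noteq> d \<Longrightarrow> push d l = d # l"
  by (cases l) auto

text \<open>Shows that neighbouring cosets in a normal form differ, so that \<open>push\<close> does
  not cancel.\<close>

lemma (in group) coset_translate_neq:
  assumes "subgroup C G" "x \<in> carrier G - C" "g \<in> carrier G"
  shows "C #> (x \<otimes> g) \<noteq> C #> g"
proof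
  assume "C #> (x \<otimes> g) = C #> g"
  moreover have "x \<otimes> g \<in> C #> (x \<otimes> g)"
    using assms by (intro rcos_self) auto
  ultimately obtain c where "c \<in> C" "x \<otimes> g = c \<otimes> g" by (auto simp: r_coset_def)
  then show False using assms subgroup.mem_carrier[OF assms(1)] by auto
qed

text \<open>Van der Waerden's normal form argument, with right cosets of \<open>C\<close> in place of coset
  representatives: the amalgamated product acts on pairs of an element of \<open>W\<close> and a normal form
  over the cosets, \<open>A\<close> through the first component only and \<open>B\<close> through the conjugate of that action
  by \<open>(w, l) \<mapsto> (w, push (C w) l)\<close>, which commutes with \<open>C\<close>.\<close>

lemma amalgam_normal_form:
  fixes W :: "('a, 'b) monoid_scheme" (structure)
  assumes "group W" and am: "decomposes_as_amalgam W A C B"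
  obtains l :: "'a \<Rightarrow> 'a set list"
  where "l \<one> = []"
    and "\<And>a w. a \<in> A \<Longrightarrow> w \<in> carrier W \<Longrightarrow> l (a \<otimes> w) = l w"
    and "\<And>b w. b \<in> B \<Longrightarrow> w \<in> carrier W \<Longrightarrow> l (b \<otimes> w) = push (C #> (b \<otimes> w)) (push (C #> w) (l w))"
proof -
  interpret group W by fact
  let ?R = "amalgam_relators (W\<lparr>carrier := A\<rparr>) (W\<lparr>carrier := B\<rparr>) (W\<lparr>carrier := C\<rparr>) id id"
  have sub: "subgroup A W" "subgroup B W" "subgroup C W" and CA: "C \<subseteq> A" and CB: "C \<subseteq> B"
    and pres: "presents W (A <+> B) ?R (case_sum (\<lambda>a. a) (\<lambda>b. b))"
    using am by (simp_all add: decomposes_as_amalgam_iff)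
  have cA: "a \<in> carrier W" if "a \<in> A" for a using that subgroup.mem_carrier[OF sub(1)] by blast
  have cB: "b \<in> carrier W" if "b \<in> B" for b using that subgroup.mem_carrier[OF sub(2)] by blast
  define sg where "sg b g = (if b then g else inv g)" for b g
  have sg: "sg b g \<in> carrier W" "sg b g \<otimes> (sg (\<not> b) g \<otimes> w) = w"
    if "g \<in> carrier W" "w \<in> carrier W" for b g w
    using that by (simp_all add: sg_def m_assoc[symmetric])
  let ?P = "carrier W \<times> {l :: 'a set list. distinct_adj l}"
  define act where "act = (\<lambda>(x, b) (w, l :: 'a set list). case x of
      Inl a \<Rightarrow> (sg b a \<otimes> w, l)
    | Inr a \<Rightarrow> (sg b a \<otimes> w, push (C #> (sg b a \<otimes> w)) (push (C #> w) l)))"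
  have cl: "act (x, b) y \<in> ?P" if "x \<in> A <+> B" "y \<in> ?P" for x b y
    using that by (auto simp: act_def sg cA cB intro!: distinct_adj_push split: sum.splits)
  have inv: "act (x, b) (act (x, \<not> b) y) = y" if "x \<in> A <+> B" "y \<in> ?P" for x b y
    using that by (auto simp: act_def sg cA cB push_push distinct_adj_push split: sum.splits)
  have rel: "foldr act r y = y" if "r \<in> ?R" "r \<in> words (A <+> B)" "y \<in> ?P" for r y
  proof -
    from that(3) obtain w l where y: "y = (w, l)" "w \<in> carrier W" "distinct_adj l" by auto
    from that(1) consider a a' where "a \<in> A" "a' \<in> A"
        "r = [(Inl a, True), (Inl a', True), (Inl (a \<otimes> a'), False)]"
      | b b' where "b \<in> B" "b' \<in> B"
        "r = [(Inr b, True), (Inr b', True), (Inr (b \<otimes> b'), False)]"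
      | c where "c \<in> C" "r = [(Inl c, True), (Inr c, False)]"
      by (auto simp: amalgam_relators_def)
    then show ?thesis
    proof cases
      case (1 a a')
      then have "a \<otimes> (a' \<otimes> (inv (a \<otimes> a') \<otimes> w)) = w"
        using cA y(2) by (simp add: m_assoc[symmetric])
      then show ?thesis using 1 y by (simp add: act_def sg_def)
    next
      case (2 b b')
      then have "b \<otimes> (b' \<otimes> (inv (b \<otimes> b') \<otimes> w)) = w"
        using cB y(2) by (simp add: m_assoc[symmetric])
      then show ?thesis using 2 y by (simp add: act_def sg_def push_push distinct_adj_push)
    next
      case (3 c)
      have c: "c \<in> carrier W" using 3 CA cA by blast
      then have "c \<otimes> (inv c \<otimes> w) = w"
        using y(2) by (simp add: m_assoc[symmetric])
      \<comment> \<open>\<open>c\<close> does not change the coset, so the two pushes of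
        \<open>Inr c\<close> cancel and both copies of \<open>c\<close> act alike.\<close>
      moreover have "C #> (inv c \<otimes> w) = C #> w"
        using 3(1) c y(2) sub(3) coset_mult_assoc[of C "inv c" w] coset_join2[of "inv c" C]
        by (simp add: subgroup.subset subgroup.m_inv_closed)
      ultimately show ?thesis using 3 y by (simp add: act_def sg_def push_push)
    qed
  qed
  obtain F where cl_F: "\<And>g y. g \<in> carrier W \<Longrightarrow> y \<in> ?P \<Longrightarrow> F g y \<in> ?P"
    and F_one: "\<And>y. y \<in> ?P \<Longrightarrow> F \<one> y = y"
    and F_mult: "\<And>g h y. g \<in> carrier W \<Longrightarrow> h \<in> carrier W \<Longrightarrow> y \<in> ?P \<Longrightarrow> F (g \<otimes> h) y = F g (F h y)"
    and F_gen: "\<And>x y. x \<in> A <+> B \<Longrightarrow> y \<in> ?P \<Longrightarrow> F (case_sum (\<lambda>a. a) (\<lambda>b. b) x) y = act (x, True) y"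
    by (rule presents_action[where P = ?P and act = act, OF assms(1) pres cl inv rel]) (assumption+, blast)
  note gen = amalgam_generate[OF assms]
  have F_A: "F a (w, l) = (a \<otimes> w, l)" if "a \<in> A" "(w, l) \<in> ?P" for a w l
    using F_gen[of "Inl a" "(w, l)"] InlI[OF that(1), of B] that by (simp add: act_def sg_def)
  have F_B: "F b (w, l) = (b \<otimes> w, push (C #> (b \<otimes> w)) (push (C #> w) l))" if "b \<in> B" "(w, l) \<in> ?P" for b w l
    using F_gen[of "Inr b" "(w, l)"] InrI[OF that(1), of A] that by (simp add: act_def sg_def)
  have fst_F: "fst (F g y) = g \<otimes> fst y" if "g \<in> generate W (A \<union> B)" "y \<in> ?P" for g y
    using that
  proof (induction arbitrary: y)
    case one
    then show ?case by (auto simp: F_one)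
  next
    case (incl h)
    then show ?case by (auto simp: F_A F_B)
  next
    case (inv h)
    then have "inv h \<in> A \<union> B" using sub by (auto simp: subgroup.m_inv_closed)
    then show ?case using inv by (auto simp: F_A F_B)
  next
    case (eng g h)
    then have gh: "g \<in> carrier W" "h \<in> carrier W" using gen by auto
    then show ?case using eng by (auto simp: F_mult cl_F m_assoc)
  qed
  \<comment> \<open>Normal forms are read off the orbit of \<open>(\<one>, [])\<close>, in which the
    first component is the group element itself.\<close>
  define l where "l w = snd (F w (\<one>, []))" for w
  have e: "(\<one>, []) \<in> ?P" by simp
  have F: "F w (\<one>, []) = (w, l w)" "(w, l w) \<in> ?P" if "w \<in> carrier W" for w
  proof -
    show *: "F w (\<one>, []) = (w, l w)"
      using fst_F[of w "(\<one>, [])"] that gen by (simp add: l_def prod_eq_iff)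
    show "(w, l w) \<in> ?P" using cl_F[OF that e] * by simp
  qed
  show thesis
  proof (rule that[of l])
    show "l \<one> = []" by (simp add: l_def F_one)
    show "l (a \<otimes> w) = l w" if "a \<in> A" "w \<in> carrier W" for a w
    proof -
      have "F (a \<otimes> w) (\<one>, []) = (a \<otimes> w, l w)"
        unfolding F_mult[OF cA[OF that(1)] that(2) e] F(1)[OF that(2)] F_A[OF that(1) F(2)[OF that(2)]] ..
      then show ?thesis by (simp only: l_def[of "a \<otimes> w"] snd_conv)
    qed
    show "l (b \<otimes> w) = push (C #> (b \<otimes> w)) (push (C #> w) (l w))" if "b \<in> B" "w \<in> carrier W" for b w
    proof -
      have "F (b \<otimes> w) (\<one>, []) = (b \<otimes> w, push (C #> (b \<otimes> w)) (push (C #> w) (l w)))"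
        unfolding F_mult[OF cB[OF that(1)] that(2) e] F(1)[OF that(2)] F_B[OF that(1) F(2)[OF that(2)]] ..
      then show ?thesis by (simp only: l_def[of "b \<otimes> w"] snd_conv)
    qed
  qed
qed

text \<open>Each factor from \<open>B\<close> pushes two cosets, and the factors from
  \<open>A\<close> in between prevent cancellation. The entry pushed first stays last: it is
  \<open>C #> \<one> = C\<close> when \<open>b\<close> acts first and \<open>C #> a\<close> when
  \<open>a\<close> does, which later separates the two families of powers.\<close>

lemma amalgam_normal_form_powers:
  fixes W :: "('a, 'b) monoid_scheme" (structure) and l :: "'a \<Rightarrow> 'a set list"
  assumes "group W" "subgroup C W"
    and l: "l \<one> = []"
      "\<And>a w. a \<in> A \<Longrightarrow> w \<in> carrier W \<Longrightarrow> l (a \<otimes> w) = l w"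
      "\<And>b w. b \<in> B \<Longrightarrow> w \<in> carrier W \<Longrightarrow> l (b \<otimes> w) = push (C #> (b \<otimes> w)) (push (C #> w) (l w))"
    and a: "a \<in> A" "a \<in> carrier W - C" and b: "b \<in> B" "b \<in> carrier W - C"
  shows "length (l ((a \<otimes> b) [^] n)) = 2 * n" "n > 0 \<Longrightarrow> last (l ((a \<otimes> b) [^] n)) = C"
    and "length (l ((b \<otimes> a) [^] n)) = 2 * n" "n > 0 \<Longrightarrow> last (l ((b \<otimes> a) [^] n)) \<noteq> C"
proof -
  interpret group W by fact
  have [simp]: "a \<in> carrier W" "b \<in> carrier W" using a b by auto
  note neq = coset_translate_neq[OF assms(2)]
  have C: "C #> \<one> = C" using assms(2) by (simp add: subgroup.subset)
  have aC: "C #> a \<noteq> C" using neq[OF a(2), of \<one>] C by simp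
  define g where "g n = (a \<otimes> b) [^] n" for n :: nat
  have g [simp]: "g n \<in> carrier W" "g 0 = \<one>" "g (Suc n) = a \<otimes> (b \<otimes> g n)" for n
    unfolding g_def by (simp_all only: nat_pow_Suc2 nat_pow_closed nat_pow_0 m_assoc m_closed \<open>a \<in> carrier W\<close> \<open>b \<in> carrier W\<close>)
  have g_Suc: "l (g (Suc n)) = (C #> (b \<otimes> g n)) # (C #> g n) # l (g n)" for n
  proof (induction n)
    case 0
    then show ?case using neq[OF b(2), of \<one>] a b l(1) l(2)[of a b] l(3)[of b \<one>] by simp
  next
    case (Suc n)
    have "push (C #> g (Suc n)) (l (g (Suc n))) = (C #> g (Suc n)) # l (g (Suc n))"
      using Suc neq[OF a(2), of "b \<otimes> g n"] by (intro push_Cons_eq) auto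
    then show ?case
      using neq[OF b(2), of "g (Suc n)"] a b l(2)[of a "b \<otimes> g (Suc n)"] l(3)[of b "g (Suc n)"] by simp
  qed
  have "length (l (g n)) = 2 * n \<and> (n > 0 \<longrightarrow> last (l (g n)) = C)" for n
  proof (induction n)
    case (Suc n)
    show ?case
    proof (cases "n = 0")
      case True
      then show ?thesis using g_Suc[of 0] C l(1) by simp
    next
      case False
      then have "l (g n) \<noteq> []" using Suc by force
      then show ?thesis using Suc False by (simp only: g_Suc) simp
    qed
  qed (simp add: l(1))
  then show "length (l ((a \<otimes> b) [^] n)) = 2 * n" "n > 0 \<Longrightarrow> last (l ((a \<otimes> b) [^] n)) = C"
    by (simp_all add: g_def)
  define h where "h n = (b \<otimes> a) [^] n" for n :: nat
  have h [simp]: "h n \<in> carrier W" "h 0 = \<one>" "h (Suc n) = b \<otimes> (a \<otimes> h n)" for n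
    unfolding h_def by (simp_all only: nat_pow_Suc2 nat_pow_closed nat_pow_0 m_assoc m_closed \<open>a \<in> carrier W\<close> \<open>b \<in> carrier W\<close>)
  have h_Suc: "l (h (Suc n)) = (C #> h (Suc n)) # (C #> (a \<otimes> h n)) # l (h n)" for n
  proof (induction n)
    case 0
    then show ?case using neq[OF b(2), of a] l(2)[of a \<one>] a b l(1) l(3)[of b a] by simp
  next
    case (Suc n)
    have "push (C #> (a \<otimes> h (Suc n))) (l (h (Suc n))) = (C #> (a \<otimes> h (Suc n))) # l (h (Suc n))"
      using Suc neq[OF a(2), of "h (Suc n)"] by (intro push_Cons_eq) auto
    then show ?case
      using neq[OF b(2), of "a \<otimes> h (Suc n)"] a b l(2)[of a "h (Suc n)"] l(3)[of b "a \<otimes> h (Suc n)"] by simp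
  qed
  have "length (l (h n)) = 2 * n \<and> (n > 0 \<longrightarrow> last (l (h n)) \<noteq> C)" for n
  proof (induction n)
    case (Suc n)
    show ?case
    proof (cases "n = 0")
      case True
      then show ?thesis using h_Suc[of 0] aC l(1) \<open>a \<in> carrier W\<close> by simp
    next
      case False
      then have "l (h n) \<noteq> []" using Suc by force
      then show ?thesis using Suc False by (simp only: h_Suc) simp
    qed
  qed (simp add: l(1))
  then show "length (l ((b \<otimes> a) [^] n)) = 2 * n" "n > 0 \<Longrightarrow> last (l ((b \<otimes> a) [^] n)) \<noteq> C"
    by (simp_all add: h_def)
qed

text \<open>The powers have normal forms of length \<open>2 * n\<close>, whereas that of \<one> is
  empty.\<close>

lemma amalgam_infinite_order:
  fixes W :: "('a, 'b) monoid_scheme" (structure)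
  assumes "group W" and am: "decomposes_as_amalgam W A C B"
    and "a \<in> A - C" "b \<in> B - C" and "(a \<otimes> b) [^] (n::nat) = \<one>"
  shows "n = 0"
proof -
  interpret group W by fact
  have sub: "subgroup A W" "subgroup B W" "subgroup C W"
    using am by (simp_all add: decomposes_as_amalgam_iff)
  obtain l :: "'a \<Rightarrow> 'a set list" where l: "l \<one> = []"
      "\<And>a w. a \<in> A \<Longrightarrow> w \<in> carrier W \<Longrightarrow> l (a \<otimes> w) = l w"
      "\<And>b w. b \<in> B \<Longrightarrow> w \<in> carrier W \<Longrightarrow> l (b \<otimes> w) = push (C #> (b \<otimes> w)) (push (C #> w) (l w))"
    by (rule amalgam_normal_form[OF assms(1,2)]) blast
  have "a \<in> carrier W" "b \<in> carrier W" using assms sub by (auto dest: subgroup.mem_carrier)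
  then have "length (l ((a \<otimes> b) [^] n)) = 2 * n"
    using assms by (intro amalgam_normal_form_powers(1)[where C = C and A = A and B = B, OF assms(1) sub(3) l]) auto
  then show ?thesis using assms(5) l(1) by simp
qed

text \<open>For finitely generated groups this means having more than one end.\<close>

definition splits_at_infinity :: "('a, 'b) monoid_scheme \<Rightarrow> bool" where
  "splits_at_infinity G \<longleftrightarrow>
    (\<exists>E\<subseteq>carrier G. infinite E \<and> infinite (carrier G - E) \<and>
      (\<forall>x\<in>carrier G. finite {w \<in> carrier G. (w \<in> E) \<noteq> (w \<otimes>\<^bsub>G\<^esub> x \<in> E)}))"

text \<open>The elements whose right multiplication moves only finitely many points into or out of
  \<open>E\<close> form a subgroup: \<open>bd (g \<otimes> h)\<close> is covered by
  \<open>bd g\<close> and a translate of \<open>bd h\<close>.\<close>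

lemma (in group) splits_at_infinityI:
  assumes E: "E \<subseteq> carrier G" "infinite E" "infinite (carrier G - E)"
    and X: "X \<subseteq> carrier G" "generate G X = carrier G"
    and fin: "\<And>x. x \<in> X \<Longrightarrow> finite {w \<in> carrier G. (w \<in> E) \<noteq> (w \<otimes> x \<in> E)}"
  shows "splits_at_infinity G"
proof -
  define bd where "bd x = {w \<in> carrier G. (w \<in> E) \<noteq> (w \<otimes> x \<in> E)}" for x
  have "finite (bd g)" if "g \<in> generate G X" for g
    using that
  proof induction
    case one
    have "bd \<one> = {}" by (auto simp: bd_def)
    then show ?case by simp
  next
    case (incl h)
    then show ?case using fin by (simp add: bd_def)
  next
    case (inv h)
    then have h: "h \<in> carrier G" using X by auto
    have "bd (inv h) \<subseteq> (\<lambda>w. w \<otimes> h) ` bd h"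
    proof
      fix w assume w: "w \<in> bd (inv h)"
      then have "w \<otimes> inv h \<otimes> h = w" using h by (simp add: bd_def m_assoc)
      moreover from this have "w \<otimes> inv h \<in> bd h" using w h by (auto simp: bd_def)
      ultimately show "w \<in> (\<lambda>w. w \<otimes> h) ` bd h" by (metis imageI)
    qed
    then show ?case using fin[OF inv] by (metis bd_def finite_surj)
  next
    case (eng g h)
    then have gh: "g \<in> carrier G" "h \<in> carrier G" using X by auto
    have "bd (g \<otimes> h) \<subseteq> bd g \<union> (\<lambda>w. w \<otimes> inv g) ` bd h"
    proof
      fix w assume w: "w \<in> bd (g \<otimes> h)"
      then have "w = w \<otimes> g \<otimes> inv g" using gh by (simp add: bd_def m_assoc)
      moreover have "w \<in> bd g \<or> w \<otimes> g \<in> bd h" using w gh by (auto simp: bd_def m_assoc)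
      ultimately show "w \<in> bd g \<union> (\<lambda>w. w \<otimes> inv g) ` bd h" by blast
    qed
    then show ?case using eng by (meson finite_UnI finite_imageI finite_subset)
  qed
  then show ?thesis using E X unfolding splits_at_infinity_def bd_def by blast
qed

lemma amalgam_splits_at_infinity:
  fixes W :: "('a, 'b) monoid_scheme" (structure)
  assumes "group W" and am: "decomposes_as_amalgam W A C B" and "finite C" "A \<noteq> C" "C \<noteq> B"
  shows "splits_at_infinity W"
proof -
  interpret group W by fact
  have sub: "subgroup A W" "subgroup B W" "subgroup C W" and CA: "C \<subseteq> A" and CB: "C \<subseteq> B"
    using am by (simp_all add: decomposes_as_amalgam_iff)
  obtain l :: "'a \<Rightarrow> 'a set list" where l: "l \<one> = []"
      "\<And>a w. a \<in> A \<Longrightarrow> w \<in> carrier W \<Longrightarrow> l (a \<otimes> w) = l w"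
      "\<And>b w. b \<in> B \<Longrightarrow> w \<in> carrier W \<Longrightarrow> l (b \<otimes> w) = push (C #> (b \<otimes> w)) (push (C #> w) (l w))"
    by (rule amalgam_normal_form[OF assms(1,2)]) blast
  obtain a b where ab: "a \<in> A" "a \<notin> C" "b \<in> B" "b \<notin> C" using assms(4,5) CA CB by blast
  have cAB: "x \<in> carrier W" if "x \<in> A \<union> B" for x using that sub by (auto dest: subgroup.mem_carrier)
  have abW: "a \<in> carrier W" "b \<in> carrier W" using ab cAB by auto
  have aW: "a \<in> carrier W - C" and bW: "b \<in> carrier W - C" using ab abW by auto
  have powers: "length (l ((a \<otimes> b) [^] n)) = 2 * n" "n > 0 \<Longrightarrow> last (l ((a \<otimes> b) [^] n)) = C"
    "length (l ((b \<otimes> a) [^] n)) = 2 * n" "n > 0 \<Longrightarrow> last (l ((b \<otimes> a) [^] n)) \<noteq> C" for n :: nat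
    using amalgam_normal_form_powers[OF assms(1) sub(3) l ab(1) aW ab(3) bW] by blast+
  \<comment> \<open>The last coset is the first one pushed; it is \<open>C\<close> when the
    rightmost syllable comes from \<open>B\<close>.\<close>
  define F where "F = {w \<in> carrier W. l w \<noteq> [] \<and> last (l w) = C}"
  \<comment> \<open>Normal forms of different lengths make the powers distinct.\<close>
  have inf: "infinite X" if "\<And>n. g (Suc n) \<in> X" "\<And>n. length (l (g n)) = 2 * n" for X g
  proof -
    have "inj (\<lambda>n. g (Suc n))"
    proof (rule injI)
      fix i j assume "g (Suc i) = g (Suc j)"
      then have "2 * Suc i = 2 * Suc j" using that(2) by metis
      then show "i = j" by simp
    qed
    then have "infinite (range (\<lambda>n. g (Suc n)))" by (rule range_inj_infinite)
    then show ?thesis using that(1) by (meson finite_subset image_subsetI)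
  qed
  have "infinite F"
  proof (rule inf)
    show "(a \<otimes> b) [^] Suc n \<in> F" for n
    proof -
      have "l ((a \<otimes> b) [^] Suc n) \<noteq> []" using powers(1)[of "Suc n"] by fastforce
      then show ?thesis using powers(2)[of "Suc n"] abW by (simp add: F_def)
    qed
  qed (rule powers(1))
  have "infinite (carrier W - F)"
  proof (rule inf)
    show "(b \<otimes> a) [^] Suc n \<in> carrier W - F" for n
      using powers(4)[of "Suc n"] abW by (simp add: F_def)
  qed (rule powers(3))
  define bd where "bd g = {w \<in> carrier W. (w \<in> F) \<noteq> (g \<otimes> w \<in> F)}" for g
  have bd_AB: "finite (bd g)" if "g \<in> A \<union> B" for g
    using that
  proof
    assume "g \<in> A"
    then have "bd g = {}" using l(2) cAB by (auto simp: bd_def F_def)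
    then show ?thesis by simp
  next
    assume g: "g \<in> B"
    then have gW: "g \<in> carrier W" using cAB by simp
    \<comment> \<open>Off \<open>C\<close> and this translate of it, neither of the two pushed
      cosets is \<open>C\<close>, and \<open>last_push\<close> applies to both.\<close>
    have "bd g \<subseteq> C \<union> (\<lambda>c. inv g \<otimes> c) ` C"
    proof
      fix w assume w: "w \<in> bd g"
      then have wW: "w \<in> carrier W" by (simp add: bd_def)
      show "w \<in> C \<union> (\<lambda>c. inv g \<otimes> c) ` C"
      proof (rule ccontr)
        assume not: "w \<notin> C \<union> (\<lambda>c. inv g \<otimes> c) ` C"
        have "w = inv g \<otimes> (g \<otimes> w)" using gW wW by (simp add: m_assoc[symmetric])
        then have "g \<otimes> w \<notin> C" using not by blast
        then have "C #> w \<noteq> C" "C #> (g \<otimes> w) \<noteq> C"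
          using not coset_join1[OF _ _ sub(3)] wW gW sub(3) by (auto dest: subgroup.subset)
        then have "l (g \<otimes> w) \<noteq> [] \<and> last (l (g \<otimes> w)) = C \<longleftrightarrow> l w \<noteq> [] \<and> last (l w) = C"
          unfolding l(3)[OF g wW] by (simp only: last_push not_False_eq_True)
        then show False using w wW gW by (auto simp: bd_def F_def)
      qed
    qed
    then show ?thesis using \<open>finite C\<close> by (meson finite_UnI finite_imageI finite_subset)
  qed
  have inv_inv_image: "(\<lambda>w. inv w) ` (\<lambda>w. inv w) ` X = X" if "X \<subseteq> carrier W" for X
    using that by (force simp: image_image)
  \<comment> \<open>Inversion turns the almost invariance of \<open>F\<close> under left
    multiplication into that under right multiplication.\<close>
  define E where "E = (\<lambda>w. inv w) ` F"
  have E_iff: "w \<in> E \<longleftrightarrow> inv w \<in> F" if "w \<in> carrier W" for w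
  proof
    assume "w \<in> E"
    then show "inv w \<in> F" by (auto simp: E_def F_def)
  next
    assume "inv w \<in> F"
    then show "w \<in> E" using that unfolding E_def by (intro image_eqI[of _ _ "inv w"]) auto
  qed
  have EW: "E \<subseteq> carrier W" by (auto simp: E_def F_def)
  have "infinite E"
    using \<open>infinite F\<close> inv_inv_image[of F] unfolding E_def
    by (metis (no_types, lifting) F_def finite_imageI mem_Collect_eq subsetI)
  moreover have "infinite (carrier W - E)"
  proof -
    have "carrier W - F \<subseteq> (\<lambda>w. inv w) ` (carrier W - E)"
    proof
      fix w assume w: "w \<in> carrier W - F"
      then show "w \<in> (\<lambda>w. inv w) ` (carrier W - E)"
        using E_iff[of "inv w"] by (intro image_eqI[of _ _ "inv w"]) auto
    qed
    then show ?thesis using \<open>infinite (carrier W - F)\<close> finite_surj by blast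
  qed
  moreover have "finite {w \<in> carrier W. (w \<in> E) \<noteq> (w \<otimes> x \<in> E)}" if x: "x \<in> A \<union> B" for x
  proof -
    have xW: "x \<in> carrier W" using cAB x by blast
    have "{w \<in> carrier W. (w \<in> E) \<noteq> (w \<otimes> x \<in> E)} \<subseteq> (\<lambda>w. inv w) ` bd (inv x)"
    proof
      fix w assume w: "w \<in> {w \<in> carrier W. (w \<in> E) \<noteq> (w \<otimes> x \<in> E)}"
      then have "inv w \<in> bd (inv x)" using xW by (auto simp: bd_def E_iff inv_mult_group)
      then show "w \<in> (\<lambda>w. inv w) ` bd (inv x)" using w by (intro image_eqI[of _ _ "inv w"]) auto
    qed
    moreover have "finite (bd (inv x))"
      using x sub by (intro bd_AB) (auto simp: subgroup.m_inv_closed)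
    ultimately show ?thesis by (meson finite_imageI finite_subset)
  qed
  ultimately show ?thesis
    using splits_at_infinityI[OF EW _ _ _ amalgam_generate[OF assms(1,2)]] cAB by blast
qed

section \<open>Ends\<close>

lemma two_le_ecard_iff: "2 \<le> ecard A \<longleftrightarrow> (\<exists>x\<in>A. \<exists>y\<in>A. x \<noteq> y)"
proof (cases "finite A")
  case True
  then have "2 \<le> ecard A \<longleftrightarrow> \<not> card A \<le> Suc 0"
    by (auto simp: ecard_def numeral_eq_enat)
  then show ?thesis using card_le_Suc0_iff_eq[OF True] by blast
next
  case False
  then obtain x where "x \<in> A" by fastforce
  moreover have "\<exists>y\<in>A. y \<noteq> x"
  proof (rule ccontr)
    assume "\<not> (\<exists>y\<in>A. y \<noteq> x)"
    then have "A \<subseteq> {x}" by blast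
    then show False using False finite_subset by blast
  qed
  ultimately show ?thesis using False by (auto simp: ecard_def)
qed

lemma one_less_ecard_iff: "1 < ecard A \<longleftrightarrow> (\<exists>x\<in>A. \<exists>y\<in>A. x \<noteq> y)"
  unfolding two_le_ecard_iff[symmetric]
  by (cases "finite A") (auto simp: ecard_def numeral_eq_enat one_enat_def)

definition edges_off :: "('v, 'b) graph_scheme \<Rightarrow> 'v set \<Rightarrow> ('v \<times> 'v) set" where
  "edges_off G T = edges G \<inter> (verts G - T) \<times> (verts G - T)"

lemma components_remove_verts:
  "components (remove_verts G T) =
    (\<lambda>u. {v \<in> verts G - T. (u, v) \<in> (edges_off G T)\<^sup>*}) ` (verts G - T)"
proof -
  have "verts G \<inter> (verts G - T) = verts G - T" by blast
  then show ?thesis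
    by (auto simp: components_def remove_verts_def induced_subgraph_def quotient_def edges_off_def)
qed

lemma sym_edges_off: "sym (edges G) \<Longrightarrow> sym (edges_off G T)"
  by (auto simp: edges_off_def sym_def)

text \<open>Symmetric reachability is an equivalence, so two components differ precisely when their
  base points are not joined.\<close>

lemma separates_iff:
  assumes "sym (edges G)"
  shows "separates T G \<longleftrightarrow> (\<exists>u\<in>verts G - T. \<exists>v\<in>verts G - T. (u, v) \<notin> (edges_off G T)\<^sup>*)"
proof -
  have s: "(v, u) \<in> (edges_off G T)\<^sup>*" if "(u, v) \<in> (edges_off G T)\<^sup>*" for u v
    using that sym_rtrancl[OF sym_edges_off[OF assms]] by (auto dest: symD)
  have "{x \<in> verts G - T. (u, x) \<in> (edges_off G T)\<^sup>*} \<noteq> {x \<in> verts G - T. (v, x) \<in> (edges_off G T)\<^sup>*}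
      \<longleftrightarrow> (u, v) \<notin> (edges_off G T)\<^sup>*" if "u \<in> verts G - T" "v \<in> verts G - T" for u v
    using that by (auto dest: s intro: rtrancl_trans)
  then show ?thesis
    unfolding separates_def two_le_ecard_iff components_remove_verts by auto
qed

lemma one_less_graph_ends_iff:
  "1 < graph_ends G \<longleftrightarrow> (\<exists>K D D'. finite K \<and> K \<subseteq> verts G \<and> D \<noteq> D' \<and> infinite D \<and> infinite D' \<and>
    D \<in> components (remove_verts G K) \<and> D' \<in> components (remove_verts G K))"
  unfolding graph_ends_def less_SUP_iff one_less_ecard_iff by (simp add: Bex_def) blast

lemma cayley_graph_simps [simp]:
  "verts (cayley_graph G X) = carrier G"
  "edges (cayley_graph G X) = {(g, h). g \<in> carrier G \<and> h \<in> carrier G \<and>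
       (\<exists>x\<in>X. h = g \<otimes>\<^bsub>G\<^esub> x \<or> g = h \<otimes>\<^bsub>G\<^esub> x)}"
  by (simp_all add: cayley_graph_def)

section \<open>Almost invariant sets and ends of Cayley graphs\<close>

context group
begin

text \<open>One infinite component off the finite set \<open>K\<close> serves as the almost
  invariant set, as edges can leave it only into \<open>K\<close>. The other infinite component lies
  in its complement.\<close>

lemma splits_at_infinity_of_ends:
  assumes X: "X \<subseteq> carrier G" "generate G X = carrier G"
    and ends: "1 < graph_ends (cayley_graph G X)"
  shows "splits_at_infinity G"
proof -
  let ?\<Gamma> = "cayley_graph G X"
  from ends obtain K D D' where K: "finite K" "K \<subseteq> carrier G"
    and D: "D \<noteq> D'" "infinite D" "infinite D'"
    and comp: "D \<in> components (remove_verts ?\<Gamma> K)" "D' \<in> components (remove_verts ?\<Gamma> K)"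
    unfolding one_less_graph_ends_iff by auto
  define R where "R = edges_off ?\<Gamma> K"
  have sym_R: "sym R"
    unfolding R_def by (rule sym_edges_off) (auto simp: sym_def)
  obtain d d' where d: "D = {v \<in> carrier G - K. (d, v) \<in> R\<^sup>*}" "D' = {v \<in> carrier G - K. (d', v) \<in> R\<^sup>*}"
    using comp unfolding components_remove_verts R_def by auto
  have "D \<inter> D' = {}"
  proof (rule ccontr)
    assume "D \<inter> D' \<noteq> {}"
    then obtain v where "(d, v) \<in> R\<^sup>*" "(d', v) \<in> R\<^sup>*" using d by auto
    then have "(d, d') \<in> R\<^sup>*" "(d', d) \<in> R\<^sup>*"
      using sym_rtrancl[OF sym_R] by (meson rtrancl_trans symD)+
    then have "D = D'" unfolding d by (auto intro: rtrancl_trans)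
    then show False using D(1) by simp
  qed
  then have "D' \<subseteq> carrier G - D" using d by auto
  moreover have "finite {w \<in> carrier G. (w \<in> D) \<noteq> (w \<otimes> x \<in> D)}" if x: "x \<in> X" for x
  proof -
    have xG: "x \<in> carrier G" using x X by auto
    have "{w \<in> carrier G. (w \<in> D) \<noteq> (w \<otimes> x \<in> D)} \<subseteq> K \<union> (\<lambda>k. k \<otimes> inv x) ` K"
    proof
      fix w assume w: "w \<in> {w \<in> carrier G. (w \<in> D) \<noteq> (w \<otimes> x \<in> D)}"
      show "w \<in> K \<union> (\<lambda>k. k \<otimes> inv x) ` K"
      proof (rule ccontr)
        assume not: "w \<notin> K \<union> (\<lambda>k. k \<otimes> inv x) ` K"
        have "w = w \<otimes> x \<otimes> inv x" using w xG by (simp add: m_assoc)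
        then have "w \<otimes> x \<notin> K" using not by blast
        then have "(w, w \<otimes> x) \<in> R" using not w x xG by (auto simp: R_def edges_off_def)
        then have "(w, w \<otimes> x) \<in> R" "(w \<otimes> x, w) \<in> R" using sym_R by (auto dest: symD)
        then have "w \<in> D \<longleftrightarrow> w \<otimes> x \<in> D"
          using not \<open>w \<otimes> x \<notin> K\<close> w xG unfolding d by (auto intro: rtrancl_into_rtrancl)
        then show False using w by simp
      qed
    qed
    then show ?thesis using K(1) by (meson finite_UnI finite_imageI finite_subset)
  qed
  ultimately show ?thesis
    using D d finite_subset X by (intro splits_at_infinityI[of D X]) blast+
qed

text \<open>Off \<open>K\<close>, the set \<open>Y\<close> is a union of components. By
  connectedness of the Cayley graph each of them is adjacent to \<open>K\<close>, which has only
  finitely many neighbours, so finitely many components cover an infinite set.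
  \<open>Y \<noteq> carrier G\<close> excludes a component that is the whole group.\<close>

lemma infinite_component:
  assumes X: "finite X" "X \<subseteq> carrier G" "generate G X = carrier G"
    and K: "finite K" "K \<subseteq> carrier G"
    and Y: "Y \<subseteq> carrier G" "infinite Y" "Y \<noteq> carrier G"
    and closed: "\<And>v w. (v, w) \<in> edges_off (cayley_graph G X) K \<Longrightarrow> v \<in> Y \<Longrightarrow> w \<in> Y"
  obtains D where "D \<in> components (remove_verts (cayley_graph G X) K)" "infinite D" "D \<subseteq> Y"
proof -
  define R where "R = edges_off (cayley_graph G X) K"
  have sym_R: "sym R"
    unfolding R_def by (rule sym_edges_off) (auto simp: sym_def)
  define D where "D u = {v \<in> carrier G - K. (u, v) \<in> R\<^sup>*}" for u
  \<comment> \<open>Both \<open>x\<close> and \<open>inv x\<close> occur because \<open>X\<close>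
    need not be closed under inverses.\<close>
  define N where "N = (\<Union>x\<in>X. (\<lambda>k. k \<otimes> x) ` K \<union> (\<lambda>k. k \<otimes> inv x) ` K)"
  have DY: "D u \<subseteq> Y" if "u \<in> Y" for u
  proof
    fix v assume "v \<in> D u"
    then have "(u, v) \<in> R\<^sup>*" by (simp add: D_def)
    then show "v \<in> Y" by induction (use that closed R_def in auto)
  qed
  text \<open>A component missing the neighbours of \<open>K\<close> would be invariant under right multiplication.\<close>
  have meet: "D u \<inter> N \<noteq> {}" if u: "u \<in> Y - K" for u
  proof
    assume disj: "D u \<inter> N = {}"
    have step: "v \<otimes> x \<in> D u \<and> v \<otimes> inv x \<in> D u" if v: "v \<in> D u" and x: "x \<in> X" for v x
    proof -
      have vx: "v \<in> carrier G" "v \<notin> K" "x \<in> carrier G" using v x X by (auto simp: D_def)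
      have "v = v \<otimes> x \<otimes> inv x" "v = v \<otimes> inv x \<otimes> x" using vx by (simp_all add: m_assoc)
      then have "v \<otimes> x \<notin> K" "v \<otimes> inv x \<notin> K"
        using disj v x unfolding N_def by blast+
      moreover from this have "(v, v \<otimes> x) \<in> R" "(v, v \<otimes> inv x) \<in> R"
        using vx x \<open>v = v \<otimes> inv x \<otimes> x\<close> by (auto simp: R_def edges_off_def)
      ultimately show ?thesis using v vx by (auto simp: D_def intro: rtrancl_into_rtrancl)
    qed
    have "v \<otimes> g \<in> D u" if "g \<in> generate G X" "v \<in> D u" for g v
      using that
    proof (induction arbitrary: v)
      case one
      then show ?case by (auto simp: D_def)
    next
      case (eng g h)
      then have "g \<in> carrier G" "h \<in> carrier G" "v \<in> carrier G" using X(3) by (auto simp: D_def)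
      moreover have "v \<otimes> g \<otimes> h \<in> D u" using eng by blast
      ultimately show ?case by (simp add: m_assoc)
    qed (use step in auto)
    moreover have "u \<in> D u" using u Y by (auto simp: D_def)
    moreover have uG: "u \<in> carrier G" using u Y by auto
    ultimately have "g \<in> D u" if "g \<in> carrier G" for g
    proof -
      have "u \<otimes> (inv u \<otimes> g) = g" using uG that by (simp add: m_assoc[symmetric])
      moreover have "inv u \<otimes> g \<in> generate G X" using uG that X(3) by simp
      ultimately show ?thesis
        using \<open>\<And>v g. g \<in> generate G X \<Longrightarrow> v \<in> D u \<Longrightarrow> v \<otimes> g \<in> D u\<close> \<open>u \<in> D u\<close> by metis
    qed
    then have "carrier G \<subseteq> Y" using DY u by blast
    then show False using Y by blast
  qed
  have "finite N" using X K by (auto simp: N_def)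
  have "Y - K \<subseteq> (\<Union>n\<in>N \<inter> (Y - K). D n)"
  proof
    fix u assume u: "u \<in> Y - K"
    obtain n where n: "n \<in> D u" "n \<in> N" using meet[OF u] by blast
    then have "(n, u) \<in> R\<^sup>*" using sym_rtrancl[OF sym_R] by (auto simp: D_def dest: symD)
    then have "u \<in> D n" using u Y by (auto simp: D_def)
    moreover have "n \<in> Y - K" using n DY[of u] u by (auto simp: D_def)
    ultimately show "u \<in> (\<Union>n\<in>N \<inter> (Y - K). D n)" using n by blast
  qed
  moreover have "infinite (Y - K)" using Y K by simp
  ultimately have "infinite (\<Union>n\<in>N \<inter> (Y - K). D n)" using finite_subset by blast
  then obtain n where n: "n \<in> Y - K" "infinite (D n)" using \<open>finite N\<close> by auto
  moreover have "D n \<in> components (remove_verts (cayley_graph G X) K)"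
    using n Y unfolding components_remove_verts D_def R_def by auto
  ultimately show thesis using that DY by blast
qed

text \<open>Deleting the finitely many vertices at which \<open>E\<close> changes along some edge
  leaves no edge between \<open>E\<close> and its complement. Both are infinite, so each contains an
  infinite component.\<close>

lemma ends_of_splits_at_infinity:
  assumes X: "finite X" "X \<subseteq> carrier G" "generate G X = carrier G" and split: "splits_at_infinity G"
  shows "1 < graph_ends (cayley_graph G X)"
proof -
  obtain E where E: "E \<subseteq> carrier G" "infinite E" "infinite (carrier G - E)"
    and fin: "\<And>x. x \<in> carrier G \<Longrightarrow> finite {w \<in> carrier G. (w \<in> E) \<noteq> (w \<otimes> x \<in> E)}"
    using split unfolding splits_at_infinity_def by blast
  define bd where "bd x = {w \<in> carrier G. (w \<in> E) \<noteq> (w \<otimes> x \<in> E)}" for x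
  define K where "K = (\<Union>x\<in>X. bd x \<union> bd (inv x))"
  have K: "finite K" "K \<subseteq> carrier G"
    using X fin by (auto simp: K_def bd_def)
  have closed: "v \<in> E \<longleftrightarrow> w \<in> E" if vw: "(v, w) \<in> edges_off (cayley_graph G X) K" for v w
  proof -
    obtain x where x: "x \<in> X" "w = v \<otimes> x \<or> v = w \<otimes> x" and v: "v \<in> carrier G" "v \<notin> K" "w \<in> carrier G"
      using vw by (auto simp: edges_off_def)
    have xG: "x \<in> carrier G" using x X by auto
    have "w = v \<otimes> x \<or> w = v \<otimes> inv x" using x(2) v xG by (auto simp: m_assoc)
    moreover have "v \<notin> bd x" "v \<notin> bd (inv x)" using v(2) x(1) by (auto simp: K_def)
    ultimately show ?thesis using v(1) by (auto simp: bd_def)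
  qed
  have "E \<noteq> {}" using E(2) by auto
  then have "E \<noteq> carrier G" "carrier G - E \<noteq> carrier G"
    using E by auto
  obtain D where D: "D \<in> components (remove_verts (cayley_graph G X) K)" "infinite D" "D \<subseteq> E"
    by (rule infinite_component[OF X K E(1,2) \<open>E \<noteq> carrier G\<close>]) (use closed in blast)
  obtain D' where D': "D' \<in> components (remove_verts (cayley_graph G X) K)" "infinite D'" "D' \<subseteq> carrier G - E"
    by (rule infinite_component[OF X K _ E(3) \<open>carrier G - E \<noteq> carrier G\<close>])
      (use closed in \<open>auto simp: edges_off_def\<close>)
  have "D \<noteq> {}" using D(2) by auto
  then have "D \<noteq> D'" using D(3) D'(3) by blast
  then show ?thesis
    unfolding one_less_graph_ends_iff cayley_graph_simps using K D(1,2) D'(1,2) by blast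
qed

text \<open>Almost invariance does not refer to a generating set, and both implications hold for
  every finite one, in particular for the one selected in \<open>num_ends\<close>.\<close>

lemma one_less_num_ends_iff:
  assumes "finitely_generated G"
  shows "1 < num_ends G \<longleftrightarrow> splits_at_infinity G"
proof -
  let ?X = "SOME X. finite X \<and> X \<subseteq> carrier G \<and> generate G X = carrier G"
  have "finite ?X \<and> ?X \<subseteq> carrier G \<and> generate G ?X = carrier G"
    using assms unfolding finitely_generated_def by (rule someI_ex)
  then show ?thesis
    unfolding num_ends_def using splits_at_infinity_of_ends ends_of_splits_at_infinity by blast
qed

end

section \<open>Visual splittings\<close>

lemma (in group) finite_subgroup_torsion:
  assumes "subgroup H G" "finite H" "g \<in> H"
  obtains n :: nat where "n > 0" "g [^] n = \<one>"
proof -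
  interpret H: subgroup H G by fact
  have g: "g \<in> carrier G" using assms(3) by simp
  have pow: "g [^] n \<in> H" for n :: nat
    by (induction n) (use assms(3) in auto)
  then have "finite (range (\<lambda>n::nat. g [^] n))"
    using assms(2) by (meson finite_subset image_subsetI)
  then have "\<not> inj (\<lambda>n::nat. g [^] n)" using range_inj_infinite by blast
  then obtain i j :: nat where ij: "i < j" "g [^] i = g [^] j"
    unfolding inj_def by (metis linorder_neqE_nat)
  have "g [^] i \<otimes> g [^] (j - i) = g [^] j" using g ij(1) by (simp add: nat_pow_mult)
  then have "g [^] i \<otimes> g [^] (j - i) = g [^] i" using ij(2) by simp
  then have "g [^] (j - i) = \<one>" using g by simp
  then show thesis using that[of "j - i"] ij(1) by simp
qed

section \<open>Splittings into special subgroups\<close>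

context coxeter
begin

text \<open>A finite \<open>m s t\<close> forces \<open>s\<close> and \<open>t\<close> into a common
  factor, so every Coxeter relator holds in the amalgamated product. The resulting homomorphism
  \<open>\<psi>\<close> from \<open>W\<close> inverts the canonical map, as \<open>presentsI\<close>
  requires.\<close>

lemma amalgam_of_cover:
  assumes P: "P \<subseteq> S" and Q: "Q \<subseteq> S" and PQ: "P \<union> Q = S"
    and inf: "\<And>s t. s \<in> P - Q \<Longrightarrow> t \<in> Q - P \<Longrightarrow> m s t = \<infinity>"
  shows "decomposes_as_amalgam W (generate W P) (generate W (P \<inter> Q)) (generate W Q)"
proof -
  let ?A = "generate W P" and ?B = "generate W Q" and ?C = "generate W (P \<inter> Q)"
  let ?f = "case_sum (\<lambda>a. a) (\<lambda>b. b)"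
  define X where "X = ?A <+> ?B"
  define R where "R = amalgam_relators (W\<lparr>carrier := ?A\<rparr>) (W\<lparr>carrier := ?B\<rparr>) (W\<lparr>carrier := ?C\<rparr>) id id"
  define G where "G = presented_group X R"
  define gen where "gen = presented_gen X R"
  have sub: "subgroup ?A W" "subgroup ?B W" "subgroup ?C W"
    using P Q S_carrier by (auto intro!: generate_is_subgroup)
  have CA: "?C \<subseteq> ?A" and CB: "?C \<subseteq> ?B" using mono_generate[of "P \<inter> Q"] by blast+
  have cA: "a \<in> carrier W" if "a \<in> ?A" for a using that subgroup.mem_carrier[OF sub(1)] by blast
  have cB: "b \<in> carrier W" if "b \<in> ?B" for b using that subgroup.mem_carrier[OF sub(2)] by blast
  interpret G: group G unfolding G_def by (rule group_presented_group)
  have gen_closed: "gen x \<in> carrier G" if "x \<in> X" for x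
    using that presented_gen_closed by (auto simp: G_def gen_def)
  have relator_G: "word_value G gen r = \<one>\<^bsub>G\<^esub>" if "r \<in> R" "r \<in> words X" for r
  proof -
    have "([] @ r @ [], [] @ []) \<in> word_equiv X R"
      by (rule word_equiv.relator) (use that in auto)
    then have "word_equiv X R `` {r} = word_equiv X R `` {[]}"
      using equiv_class_eq[OF equiv_word_equiv] by simp
    then show ?thesis
      using word_value_presented_gen[OF that(2), of R] by (simp add: G_def gen_def presented_group_def)
  qed
  \<comment> \<open>The variable \<open>\<iota>\<close> is one of the two injections, so that both
    factors are treated at once.\<close>
  have gen_mult: "gen (\<iota> a) \<otimes>\<^bsub>G\<^esub> gen (\<iota> b) = gen (\<iota> (a \<otimes> b))"
    if "\<iota> = Inl \<and> a \<in> ?A \<and> b \<in> ?A \<or> \<iota> = Inr \<and> a \<in> ?B \<and> b \<in> ?B" for \<iota> a b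
  proof -
    let ?r = "[(\<iota> a, True), (\<iota> b, True), (\<iota> (a \<otimes> b), False)]"
    have mem: "\<iota> a \<in> X" "\<iota> b \<in> X" "\<iota> (a \<otimes> b) \<in> X"
      using that sub by (auto simp: X_def subgroup.m_closed)
    have "?r \<in> R" using that by (auto simp: R_def amalgam_relators_def)
    then have "gen (\<iota> a) \<otimes>\<^bsub>G\<^esub> (gen (\<iota> b) \<otimes>\<^bsub>G\<^esub> inv\<^bsub>G\<^esub> gen (\<iota> (a \<otimes> b))) = \<one>\<^bsub>G\<^esub>"
      using relator_G[of ?r] mem gen_closed by simp
    then have "gen (\<iota> a) \<otimes>\<^bsub>G\<^esub> gen (\<iota> b) \<otimes>\<^bsub>G\<^esub> inv\<^bsub>G\<^esub> gen (\<iota> (a \<otimes> b)) = \<one>\<^bsub>G\<^esub>"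
      using mem gen_closed by (simp add: G.m_assoc)
    then show ?thesis
      using mem gen_closed G.inv_solve_right'[of "\<one>\<^bsub>G\<^esub>" "gen (\<iota> a) \<otimes>\<^bsub>G\<^esub> gen (\<iota> b)" "gen (\<iota> (a \<otimes> b))"] by simp
  qed
  have gen_one: "gen (\<iota> \<one>) = \<one>\<^bsub>G\<^esub>" if "\<iota> = Inl \<or> \<iota> = Inr" for \<iota>
  proof -
    have "gen (\<iota> \<one>) \<in> carrier G" using that by (auto intro!: gen_closed generate.one simp: X_def)
    moreover have "gen (\<iota> \<one>) \<otimes>\<^bsub>G\<^esub> gen (\<iota> \<one>) = gen (\<iota> \<one>)"
      using gen_mult[of \<iota> \<one> \<one>] that by (auto intro: generate.one)
    ultimately show ?thesis by (metis G.r_cancel_one)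
  qed
  have gen_C: "gen (Inl c) = gen (Inr c)" if "c \<in> ?C" for c
  proof -
    let ?r = "[(Inl c, True), (Inr c, False)]"
    have mem: "Inl c \<in> X" "Inr c \<in> X" using that CA CB by (auto simp: X_def)
    have "?r \<in> R" using that by (auto simp: R_def amalgam_relators_def)
    then have "gen (Inl c) \<otimes>\<^bsub>G\<^esub> inv\<^bsub>G\<^esub> gen (Inr c) = \<one>\<^bsub>G\<^esub>"
      using relator_G[of ?r] mem gen_closed by simp
    then show ?thesis
      using mem gen_closed G.inv_solve_right'[of "\<one>\<^bsub>G\<^esub>" "gen (Inl c)" "gen (Inr c)"] by simp
  qed
  \<comment> \<open>A letter common to \<open>P\<close> and \<open>Q\<close> is placed on the left;
    by \<open>gen_C\<close> its right copy is the same element.\<close>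
  define \<gamma> where "\<gamma> s = (if s \<in> P then Inl s else Inr s)" for s :: 'a
  have \<gamma>X: "\<gamma> s \<in> X" if "s \<in> S" for s
    using that PQ by (auto simp: \<gamma>_def X_def intro: generate.incl)
  have \<gamma>Q: "gen (\<gamma> s) = gen (Inr s)" if "s \<in> Q" for s
    using that gen_C by (auto simp: \<gamma>_def intro: generate.incl)
  have coxeter_rel: "word_value G (\<lambda>s. gen (\<gamma> s)) r = \<one>\<^bsub>G\<^esub>" if "r \<in> coxeter_relators S m" for r
  proof -
    from that obtain s t where st: "s \<in> S" "t \<in> S" "m s t < \<infinity>"
      and r: "r = concat (replicate (the_enat (m s t)) [(s, True), (t, True)])"
      by (auto simp: coxeter_relators_def)
    have "\<not> (s \<in> P - Q \<and> t \<in> Q - P)" "\<not> (t \<in> P - Q \<and> s \<in> Q - P)"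
      using st(3) inf m_props(2)[OF st(1,2)] by (metis less_irrefl)+
    then have "s \<in> P \<and> t \<in> P \<or> s \<in> Q \<and> t \<in> Q"
      using st(1,2) PQ by blast
    then obtain \<iota> where \<iota>: "\<iota> = Inl \<and> s \<in> ?A \<and> t \<in> ?A \<or> \<iota> = Inr \<and> s \<in> ?B \<and> t \<in> ?B"
      and \<gamma>: "gen (\<gamma> s) = gen (\<iota> s)" "gen (\<gamma> t) = gen (\<iota> t)"
    proof
      assume "s \<in> P \<and> t \<in> P"
      then show thesis by (intro that[of Inl]) (auto simp: \<gamma>_def intro: generate.incl)
    next
      assume "s \<in> Q \<and> t \<in> Q"
      then show thesis by (intro that[of Inr]) (auto simp: \<gamma>Q intro: generate.incl)
    qed
    \<comment> \<open>Inside one factor the power can be computed in \<open>W\<close>, where the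
      relator is trivial.\<close>
    have pow: "(gen (\<iota> s) \<otimes>\<^bsub>G\<^esub> gen (\<iota> t)) [^]\<^bsub>G\<^esub> n = gen (\<iota> ((s \<otimes> t) [^] n))" for n :: nat
    proof (induction n)
      case 0
      then show ?case using \<iota> gen_one by auto
    next
      case (Suc n)
      have "(s \<otimes> t) [^] n \<in> ?A" if "s \<in> ?A" "t \<in> ?A" for n :: nat
        by (induction n) (use that in \<open>auto intro: generate.one generate.eng\<close>)
      moreover have "(s \<otimes> t) [^] n \<in> ?B" if "s \<in> ?B" "t \<in> ?B" for n :: nat
        by (induction n) (use that in \<open>auto intro: generate.one generate.eng\<close>)
      ultimately show ?case
        using \<iota> Suc by (auto simp: gen_mult generate.eng)
    qed
    have "word_value G (\<lambda>s. gen (\<gamma> s)) r = (gen (\<gamma> s) \<otimes>\<^bsub>G\<^esub> gen (\<gamma> t)) [^]\<^bsub>G\<^esub> the_enat (m s t)"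
      unfolding r by (rule G.word_value_power) (use st \<gamma>X gen_closed in auto)
    also have "\<dots> = gen (\<iota> \<one>)" by (simp only: \<gamma> pow pow_m[OF st])
    finally show ?thesis using \<iota> gen_one by auto
  qed
  have \<gamma>_closed: "(\<lambda>s. gen (\<gamma> s)) \<in> S \<rightarrow> carrier G" using \<gamma>X gen_closed by auto
  obtain \<psi> where \<psi>: "\<psi> \<in> hom W G" and \<psi>_S: "\<And>s. s \<in> S \<Longrightarrow> \<psi> s = gen (\<gamma> s)"
    by (rule presents_hom[OF is_group G.is_group presents_W \<gamma>_closed coxeter_rel]) blast+
  interpret \<psi>: group_hom W G \<psi>
    using \<psi> by unfold_locales
  have \<psi>_A: "\<psi> (val u) = gen (Inl (val u))" if "set u \<subseteq> P" for u
    using that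
  proof (induction u)
    case Nil
    then show ?case using gen_one by simp
  next
    case (Cons s u)
    then have "val u \<in> ?A" "s \<in> ?A" using generate_eq_val[OF P] by (auto intro: generate.incl)
    moreover have "set u \<subseteq> S" "s \<in> S" "s \<in> P" using Cons P by auto
    ultimately show ?case using Cons gen_mult[of Inl s "val u"] by (simp add: \<psi>_S \<gamma>_def)
  qed
  have \<psi>_B: "\<psi> (val u) = gen (Inr (val u))" if "set u \<subseteq> Q" for u
    using that
  proof (induction u)
    case Nil
    then show ?case using gen_one by simp
  next
    case (Cons s u)
    then have "val u \<in> ?B" "s \<in> ?B" using generate_eq_val[OF Q] by (auto intro: generate.incl)
    moreover have "set u \<subseteq> S" "s \<in> S" "s \<in> Q" using Cons Q by auto
    ultimately show ?case using Cons gen_mult[of Inr s "val u"] by (simp add: \<psi>_S \<gamma>Q)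
  qed
  have f: "?f \<in> X \<rightarrow> carrier W" using cA cB by (auto simp: X_def)
  have "presents W X R ?f"
  proof (rule presentsI[OF is_group f])
    show "word_value W ?f r = \<one>" if r: "r \<in> R" for r
      using r cA cB by (auto simp: R_def amalgam_relators_def m_assoc[symmetric] dest: CA[THEN subsetD])
    show "carrier W \<subseteq> word_value W ?f ` words X"
    proof
      fix g assume "g \<in> carrier W"
      then obtain u where u: "set u \<subseteq> S" "g = val u" using carrier_eq_val by auto
      from u(1) have "word_value W ?f (map (\<lambda>s. (\<gamma> s, True)) u) = val u \<and> map (\<lambda>s. (\<gamma> s, True)) u \<in> words X"
        by (induction u) (auto simp: \<gamma>X, auto simp: \<gamma>_def)
      then show "g \<in> word_value W ?f ` words X" using u(2) by (metis imageI)
    qed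
    show "\<psi> \<in> hom W (presented_group X R)" using \<psi> by (simp add: G_def)
    show "\<psi> (?f x) = presented_gen X R x" if "x \<in> X" for x
      using that \<psi>_A \<psi>_B generate_eq_val[OF P] generate_eq_val[OF Q] by (auto simp: X_def gen_def)
  qed
  then show ?thesis
    using sub CA CB by (simp add: decomposes_as_amalgam_iff X_def R_def)
qed

lemma finite_special_edge:
  assumes T: "T \<subseteq> S" "finite (generate W T)" and st: "s \<in> T" "t \<in> T" "s \<noteq> t"
  shows "m s t < \<infinity>"
proof (rule ccontr)
  assume "\<not> m s t < \<infinity>"
  then have ms: "m s t = \<infinity>" by simp
  have S: "s \<in> S" "t \<in> S" using T st by auto
  have Int: "(S - {s}) \<inter> (S - {t}) = S - {s, t}" by auto
  have am: "decomposes_as_amalgam W (generate W (S - {s})) (generate W (S - {s, t})) (generate W (S - {t}))"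
    unfolding Int[symmetric]
  proof (rule amalgam_of_cover)
    show "m x y = \<infinity>" if "x \<in> S - {s} - (S - {t})" "y \<in> S - {t} - (S - {s})" for x y
      using that ms m_props(2)[OF S] by auto
  qed (use st in auto)
  \<comment> \<open>By \<open>S_in_generate\<close> neither letter lies in the amalgamated subgroup,
    so \<open>t \<otimes> s\<close> is a product of one syllable from each factor.\<close>
  have "t \<in> generate W (S - {s}) - generate W (S - {s, t})" "s \<in> generate W (S - {t}) - generate W (S - {s, t})"
    using S st(3) S_in_generate[of "S - {s, t}"] by (auto intro: generate.incl)
  note inf_order = amalgam_infinite_order[OF is_group am this]
  have "subgroup (generate W T) W" using T S_carrier by (intro generate_is_subgroup) auto
  moreover have "t \<otimes> s \<in> generate W T" using st by (auto intro: generate.incl generate.eng)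
  ultimately obtain n :: nat where n: "n > 0" "(t \<otimes> s) [^] n = \<one>"
    using finite_subgroup_torsion T(2) by metis
  then show False using inf_order[OF n(2)] by simp
qed

text \<open>Finitely many generators of \<open>W\<close> involve only finitely many letters
  \<open>T\<close>. These already generate \<open>W\<close>, and \<open>S_in_generate\<close> puts
  every element of \<open>S\<close> into \<open>T\<close>.\<close>

lemma finite_S:
  assumes "finitely_generated W"
  shows "finite S"
proof -
  obtain X where X: "finite X" "X \<subseteq> carrier W" "generate W X = carrier W"
    using assms by (auto simp: finitely_generated_def)
  have "\<forall>x\<in>X. \<exists>u. set u \<subseteq> S \<and> val u = x"
    using X(2) unfolding carrier_eq_val by blast
  then obtain u where u: "\<And>x. x \<in> X \<Longrightarrow> set (u x) \<subseteq> S \<and> val (u x) = x" by metis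
  define T where "T = (\<Union>x\<in>X. set (u x))"
  have T: "finite T" "T \<subseteq> S" using X u by (auto simp: T_def)
  have "X \<subseteq> generate W T"
    unfolding generate_eq_val[OF T(2)] using u by (force simp: T_def)
  moreover have "subgroup (generate W T) W" using T S_carrier by (intro generate_is_subgroup) auto
  ultimately have "carrier W \<subseteq> generate W T" using X(3) generate_subgroup_incl by metis
  then have "S \<subseteq> T" using S_in_generate[OF T(2)] S_carrier by blast
  then show ?thesis using T(1) finite_subset by blast
qed

section \<open>Connectedness at infinity\<close>

lemma len_eq_0: "g \<in> carrier W \<Longrightarrow> len g = 0 \<Longrightarrow> g = \<one>"
  using reduced_word by (metis length_0_conv val_simps(1))

text \<open>Walks along the coset \<open>w\<langle>s, t\<rangle>\<close>, a polygon whose only lowest vertex is \<open>w\<close>.\<close>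

lemma polygon_constant:
  assumes st: "s \<in> S" "t \<in> S" "m s t < \<infinity>" and w: "w \<in> carrier W"
    and asc: "len w < len (w \<otimes> s)" "len w < len (w \<otimes> t)"
    and E: "\<And>v x. v \<in> carrier W \<Longrightarrow> x \<in> S \<Longrightarrow> len w < len v \<Longrightarrow> len w < len (v \<otimes> x) \<Longrightarrow>
      v \<in> E \<longleftrightarrow> v \<otimes> x \<in> E"
  shows "w \<otimes> s \<in> E \<longleftrightarrow> w \<otimes> t \<in> E"
proof -
  define x where "x i = (if even i then s else t)" for i :: nat
  \<comment> \<open>Prefixes of the alternating word \<open>s t s t ...\<close>; the walk leaves
    \<one> along \<open>s\<close>.\<close>
  define p where "p = rec_nat \<one> (\<lambda>i g. g \<otimes> x i)"
  have p [simp]: "p 0 = \<one>" "p (Suc i) = p i \<otimes> x i" for i by (simp_all add: p_def)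
  have x: "x i \<in> {s, t}" "x i \<in> S" for i using st by (simp_all add: x_def)
  have T: "{s, t} \<subseteq> S" using st by simp
  have pT: "p i \<in> generate W {s, t}" for i
    by (induction i) (use x in \<open>auto intro: generate.one generate.eng generate.incl\<close>)
  have pW: "p i \<in> carrier W" for i
    by (induction i) (use x in auto)
  have p_even: "p (2 * i) = (s \<otimes> t) [^] i" for i
  proof (induction i)
    case (Suc i)
    then show ?case using st pW[of "2 * i"] by (simp add: x_def m_assoc)
  qed simp
  have parity: "even (len (p i)) \<longleftrightarrow> even i" for i
  proof (induction i)
    case (Suc i)
    then show ?case using len_mult_S[OF pW[of i] x(2)[of i]] by auto
  qed simp
  have "1 \<le> m s t" using m_props(1) st by blast
  then have "the_enat (m s t) > 0"
    using st(3) by (cases "m s t") (auto simp: one_enat_def)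
  then have ex: "\<exists>k>0. p k = \<one>"
    using p_even[of "the_enat (m s t)"] pow_m[OF st] by (intro exI[of _ "2 * the_enat (m s t)"]) simp
  \<comment> \<open>The first return to \<one>. It is even by parity, so the last letter is
    \<open>t\<close> and the vertex before the return is \<open>t\<close> itself.\<close>
  define k where "k = (LEAST k. k > 0 \<and> p k = \<one>)"
  have k: "k > 0" "p k = \<one>" using LeastI_ex[OF ex] by (simp_all add: k_def)
  have least: "p i \<noteq> \<one>" if "0 < i" "i < k" for i
    using not_less_Least[of i "\<lambda>k. k > 0 \<and> p k = \<one>"] that by (auto simp: k_def)
  have "even k" using parity[of k] k(2) by simp
  define j where "j = k - 1"
  have kj: "k = Suc j" "odd j" using k(1) \<open>even k\<close> by (auto simp: j_def)
  then have "p j \<otimes> t = \<one>" using k(2) by (simp add: x_def)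
  then have "p j \<otimes> t \<otimes> t = t" using st by simp
  then have pj: "p j = t" using st pW by simp
  \<comment> \<open>Lengths add in the coset since \<open>s\<close> and \<open>t\<close> are ascents
    of \<open>w\<close>, and the vertices before the return differ from \<one>.\<close>
  have high: "len w < len (w \<otimes> p i)" if "0 < i" "i < k" for i
  proof -
    have "len (w \<otimes> p i) = len w + len (p i)"
      by (rule len_mult_special[OF T w _ pT]) (use asc in auto)
    moreover have "len (p i) \<noteq> 0" using len_eq_0[OF pW] least that by blast
    ultimately show ?thesis by simp
  qed
  have "w \<otimes> p (Suc i) \<in> E \<longleftrightarrow> w \<otimes> s \<in> E" if "Suc i < k" for i
    using that
  proof (induction i)
    case 0
    then show ?case using st by (simp add: x_def)
  next
    case (Suc i)
    have "w \<otimes> p (Suc i) \<in> E \<longleftrightarrow> w \<otimes> p (Suc i) \<otimes> x (Suc i) \<in> E"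
      using w pW x(2) high[of "Suc i"] high[of "Suc (Suc i)"] Suc.prems
      by (intro E) (simp_all add: m_assoc del: p(2), simp_all add: m_assoc)
    then show ?case using Suc w pW[of "Suc i"] x(2) by (simp add: m_assoc)
  qed
  from this[of "j - 1"] show ?thesis using kj pj by (cases j) auto
qed

text \<open>Connectedness of the part of length at least \<open>n\<close>, phrased through sets
  \<open>E\<close> that none of its edges crosses; in this form the induction extends a set instead
  of rerouting paths. The relation in \<open>conn\<close> is the diagram restricted to the ascents
  of \<open>w\<close>.\<close>

lemma constant_at_infinity:
  assumes conn: "\<And>w s t. w \<in> carrier W \<Longrightarrow> s \<in> S \<Longrightarrow> t \<in> S \<Longrightarrow> len w < len (w \<otimes> s) \<Longrightarrow> len w < len (w \<otimes> t) \<Longrightarrow>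
      (s, t) \<in> {(a, b). a \<in> S \<and> b \<in> S \<and> m a b < \<infinity> \<and> len w < len (w \<otimes> a) \<and> len w < len (w \<otimes> b)}\<^sup>*"
    and E: "\<And>w s. w \<in> carrier W \<Longrightarrow> s \<in> S \<Longrightarrow> n \<le> len w \<Longrightarrow> n \<le> len (w \<otimes> s) \<Longrightarrow> w \<in> E \<longleftrightarrow> w \<otimes> s \<in> E"
    and vw: "v \<in> carrier W" "w \<in> carrier W" "n \<le> len v" "n \<le> len w"
  shows "v \<in> E \<longleftrightarrow> w \<in> E"
  using E vw
proof (induction n arbitrary: E v w)
  case 0
  have "val u \<in> E \<longleftrightarrow> \<one> \<in> E" if "set u \<subseteq> S" for u
    using that
  proof (induction u rule: rev_induct)
    case (snoc s u)
    then show ?case using 0(1)[of "val u" s] by (simp add: val_snoc)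
  qed simp
  then have "g \<in> E \<longleftrightarrow> \<one> \<in> E" if "g \<in> carrier W" for g
    using that unfolding carrier_eq_val by blast
  from this[OF 0(2)] this[OF 0(3)] show ?case by simp
next
  case (Suc n)
  text \<open>Extend \<open>E\<close> to the elements of length \<open>n\<close> by the value at any of their upper neighbours.\<close>
  have up: "w \<otimes> s \<in> E \<longleftrightarrow> w \<otimes> t \<in> E"
    if w: "w \<in> carrier W" "len w = n" and st: "s \<in> S" "t \<in> S" "len w < len (w \<otimes> s)" "len w < len (w \<otimes> t)" for w s t
    using conn[OF w(1) st]
  proof induction
    case (step a b)
    have "w \<otimes> a \<in> E \<longleftrightarrow> w \<otimes> b \<in> E"
    proof (rule polygon_constant)
      show "g \<in> E \<longleftrightarrow> g \<otimes> x \<in> E"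
        if "g \<in> carrier W" "x \<in> S" "len w < len g" "len w < len (g \<otimes> x)" for g x
        using Suc.prems(1)[OF that(1,2)] that(3,4) w(2) by simp
    qed (use step(2) w in auto)
    then show ?case using step by blast
  qed simp
  \<comment> \<open>An element of length \<open>n\<close> without upper neighbours falls outside
    \<open>E'\<close>; all its edges lead below length \<open>n\<close>, so none of them is
    tested.\<close>
  define E' where "E' = {g. if len g = n then \<exists>s\<in>S. len g < len (g \<otimes> s) \<and> g \<otimes> s \<in> E else g \<in> E}"
  have E': "g \<in> E' \<longleftrightarrow> g \<otimes> s \<in> E'" if g: "g \<in> carrier W" "s \<in> S" "n \<le> len g" "n \<le> len (g \<otimes> s)" for g s
  proof -
    have low: "g \<in> E' \<longleftrightarrow> g \<otimes> s \<in> E" if "g \<in> carrier W" "s \<in> S" "len g = n" "len g < len (g \<otimes> s)" for g s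
    proof
      assume "g \<in> E'"
      with that(3) obtain t where "t \<in> S" "len g < len (g \<otimes> t)" "g \<otimes> t \<in> E"
        by (auto simp: E'_def)
      then show "g \<otimes> s \<in> E" using up[OF that(1,3) _ that(2) _ that(4)] by blast
    next
      assume "g \<otimes> s \<in> E"
      then show "g \<in> E'" using that(2-4) by (auto simp: E'_def)
    qed
    consider "len g = n" "len (g \<otimes> s) = Suc n" | "len g = Suc n" "len (g \<otimes> s) = n"
      | "Suc n \<le> len g" "Suc n \<le> len (g \<otimes> s)"
      using g len_mult_S[OF g(1,2)] by linarith
    then show ?thesis
    proof cases
      case 1
      then show ?thesis using low[of g s] g by (simp add: E'_def)
    next
      case 2
      then show ?thesis using low[of "g \<otimes> s" s] g by (simp add: E'_def)
    next
      case 3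
      then show ?thesis using Suc.prems(1)[OF g(1,2)] by (simp add: E'_def)
    qed
  qed
  have "v \<in> E' \<longleftrightarrow> w \<in> E'"
    by (rule Suc.IH) (use E' Suc.prems(2-5) in \<open>simp_all only: Suc_leD\<close>)
  then show ?case using Suc.prems(4,5) by (simp add: E'_def)
qed

lemma sym_edges_presentation_diagram: "sym (edges (presentation_diagram S m))"
  by (auto simp: presentation_diagram_def sym_def m_props(2))

text \<open>Only finitely many edges cross an almost invariant set \<open>E\<close>, so none joins
  two sufficiently long elements. Then all long elements lie on the same side, and \<open>E\<close>
  or its complement consists of short elements and is finite.\<close>

lemma not_splits_at_infinity:
  assumes fin: "finite S"
    and conn: "\<And>T. T \<subseteq> S \<Longrightarrow> complete_graph (induced_subgraph (presentation_diagram S m) T) \<Longrightarrow>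
      finite (generate W T) \<Longrightarrow> \<not> separates T (presentation_diagram S m)"
  shows "\<not> splits_at_infinity W"
proof
  assume "splits_at_infinity W"
  then obtain E where E: "E \<subseteq> carrier W" "infinite E" "infinite (carrier W - E)"
    and bd: "\<And>x. x \<in> carrier W \<Longrightarrow> finite {w \<in> carrier W. (w \<in> E) \<noteq> (w \<otimes> x \<in> E)}"
    unfolding splits_at_infinity_def by blast
  define K where "K = (\<Union>s\<in>S. {w \<in> carrier W. (w \<in> E) \<noteq> (w \<otimes> s \<in> E)})"
  have "finite K" using fin bd by (simp add: K_def)
  \<comment> \<open>The inserted 0 covers an empty \<open>K\<close>.\<close>
  define n where "n = Suc (Max (insert 0 (len ` K)))"
  have K: "len w < n" if "w \<in> K" for w
    using that \<open>finite K\<close> by (simp add: n_def less_Suc_eq_le)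
  have const: "v \<in> E \<longleftrightarrow> w \<in> E"
    if "v \<in> carrier W" "w \<in> carrier W" "n \<le> len v" "n \<le> len w" for v w
  proof (rule constant_at_infinity[where n = n])
    show "g \<in> E \<longleftrightarrow> g \<otimes> s \<in> E" if "g \<in> carrier W" "s \<in> S" "n \<le> len g" for g s
      using K[of g] that by (force simp: K_def)
    fix g s t
    assume g: "g \<in> carrier W" and st: "s \<in> S" "t \<in> S" "len g < len (g \<otimes> s)" "len g < len (g \<otimes> t)"
    \<comment> \<open>The descent set: it generates a finite subgroup, hence spans a complete graph.
      Its complement in \<open>S\<close> consists of the ascents, since no generator preserves the
      length.\<close>
    define T where "T = {x \<in> S. len (g \<otimes> x) < len g}"
    have T: "T \<subseteq> S" by (auto simp: T_def)
    have off: "x \<in> S - T \<longleftrightarrow> x \<in> S \<and> len g < len (g \<otimes> x)" for x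
      using len_mult_S[OF g, of x] by (auto simp: T_def)
    have finT: "finite (generate W T)"
      by (rule finite_generate_descents[OF fin T g]) (simp add: T_def)
    have "complete_graph (induced_subgraph (presentation_diagram S m) T)"
      using finite_special_edge[OF T finT] T
      by (auto simp: complete_graph_def induced_subgraph_def presentation_diagram_def)
    then have "\<not> separates T (presentation_diagram S m)" using conn T finT by blast
    then have "(s, t) \<in> (edges_off (presentation_diagram S m) T)\<^sup>*"
    proof -
      have "s \<in> S - T" "t \<in> S - T" using st off by blast+
      moreover have "verts (presentation_diagram S m) = S" by (simp add: presentation_diagram_def)
      ultimately show ?thesis
        using \<open>\<not> separates T (presentation_diagram S m)\<close>
        unfolding separates_iff[OF sym_edges_presentation_diagram] by blast
    qed
    then show "(s, t) \<in> {(a, b). a \<in> S \<and> b \<in> S \<and> m a b < \<infinity> \<and> len g < len (g \<otimes> a) \<and> len g < len (g \<otimes> b)}\<^sup>*"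
      by (rule rtrancl_mono[THEN subsetD, rotated])
        (use off in \<open>auto simp: edges_off_def presentation_diagram_def\<close>)
  qed (use that in auto)
  have "E \<subseteq> {g \<in> carrier W. len g \<le> n} \<or> carrier W - E \<subseteq> {g \<in> carrier W. len g \<le> n}"
  proof (rule ccontr)
    assume "\<not> ?thesis"
    then obtain v w where "v \<in> E" "n \<le> len v" "w \<in> carrier W - E" "n \<le> len w"
      using E(1) by fastforce
    then show False using const[of v w] E(1) by blast
  qed
  then show False using E(2,3) finite_len_le[OF fin] finite_subset by blast
qed

text \<open>With \<open>U\<close> the component of \<open>u\<close> in the diagram without
  \<open>T\<close>, the sets \<open>T \<union> U\<close> and \<open>S - U\<close> cover
  \<open>S\<close> and meet in \<open>T\<close>, and no edge joins their differences. The vertices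
  \<open>u\<close> and \<open>v\<close> from different components make both factors larger than the
  amalgamated subgroup.\<close>

lemma amalgam_of_separating:
  assumes T: "T \<subseteq> S" and sep: "separates T (presentation_diagram S m)"
  obtains P Q where "P \<subseteq> S" "Q \<subseteq> S"
    "nontrivial_amalgam_decomposition W (generate W P) (generate W T) (generate W Q)"
proof -
  let ?\<Gamma> = "presentation_diagram S m"
  define R where "R = edges_off ?\<Gamma> T"
  obtain u v where u: "u \<in> S - T" and v: "v \<in> S - T" and uv: "(u, v) \<notin> R\<^sup>*"
    using sep unfolding separates_iff[OF sym_edges_presentation_diagram] R_def
    by (auto simp: presentation_diagram_def)
  define U where "U = {x \<in> S - T. (u, x) \<in> R\<^sup>*}"
  have Int: "(T \<union> U) \<inter> (S - U) = T" using T by (auto simp: U_def)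
  have "decomposes_as_amalgam W (generate W (T \<union> U)) (generate W ((T \<union> U) \<inter> (S - U))) (generate W (S - U))"
  proof (rule amalgam_of_cover)
    show "m x y = \<infinity>" if "x \<in> T \<union> U - (S - U)" "y \<in> S - U - (T \<union> U)" for x y
    proof (rule ccontr)
      assume "m x y \<noteq> \<infinity>"
      moreover have "x \<in> U" "y \<in> S - T" "y \<notin> U" using that T by auto
      moreover from this have "x \<noteq> y" by auto
      ultimately have "(x, y) \<in> R" by (auto simp: R_def edges_off_def presentation_diagram_def U_def)
      then show False
        using \<open>x \<in> U\<close> \<open>y \<in> S - T\<close> \<open>y \<notin> U\<close> by (auto simp: U_def intro: rtrancl_into_rtrancl)
    qed
  qed (use T in \<open>auto simp: U_def\<close>)
  then have "decomposes_as_amalgam W (generate W (T \<union> U)) (generate W T) (generate W (S - U))"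
    by (simp only: Int)
  moreover have "u \<in> generate W (T \<union> U)" "u \<notin> generate W T"
    using u S_in_generate[OF T] by (auto simp: U_def intro: generate.incl)
  moreover have "v \<in> generate W (S - U)" "v \<notin> generate W T"
    using v uv S_in_generate[OF T] by (auto simp: U_def intro: generate.incl)
  ultimately show thesis
    using that[of "T \<union> U" "S - U"] T by (auto simp: nontrivial_amalgam_decomposition_def U_def)
qed

end

theorem corollary16:
  fixes W :: "('a, 'b) monoid_scheme" and S :: "'a set" and m :: "'a \<Rightarrow> 'a \<Rightarrow> enat"
  assumes "coxeter_system W S m"
    and "finitely_generated W"
  shows "(1 < num_ends W
      \<longleftrightarrow> (\<exists>A B C. special_subgroup W S A \<and> special_subgroup W S B \<and> special_subgroup W S C \<and>
            finite C \<and> nontrivial_amalgam_decomposition W A C B))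
    \<and> ((\<exists>A B C. special_subgroup W S A \<and> special_subgroup W S B \<and> special_subgroup W S C \<and>
            finite C \<and> nontrivial_amalgam_decomposition W A C B)
      \<longleftrightarrow> (\<exists>T\<subseteq>S. complete_graph (induced_subgraph (presentation_diagram S m) T) \<and>
            separates T (presentation_diagram S m) \<and> finite (generate W T)))"
    (is "(?ends \<longleftrightarrow> ?amalgam) \<and> (?amalgam \<longleftrightarrow> ?separating)")
proof -
  interpret coxeter W S m
    using assms(1) by (simp add: coxeter_def coxeter_axioms_def coxeter_system_def)
  note ends_iff = one_less_num_ends_iff[OF assms(2)]
  have "?ends" if "?amalgam"
  proof -
    from that obtain A B C where "finite C" "nontrivial_amalgam_decomposition W A C B" by blast
    then show ?thesis
      unfolding ends_iff nontrivial_amalgam_decomposition_def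
      using amalgam_splits_at_infinity[OF is_group, of A C B] by simp
  qed
  moreover have "?separating" if "?ends"
    using that not_splits_at_infinity[OF finite_S[OF assms(2)]] unfolding ends_iff by blast
  moreover have "?amalgam" if "?separating"
  proof -
    from that obtain T where T: "T \<subseteq> S" "separates T (presentation_diagram S m)" "finite (generate W T)"
      by blast
    obtain P Q where PQ: "P \<subseteq> S" "Q \<subseteq> S"
      "nontrivial_amalgam_decomposition W (generate W P) (generate W T) (generate W Q)"
      by (rule amalgam_of_separating[OF T(1,2)])
    have "special_subgroup W S (generate W X)" if "X \<subseteq> S" for X
      using that by (auto simp: special_subgroup_def)
    then show ?thesis using PQ T by blast
  qed
  ultimately show ?thesis by blast
qed

end
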